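(* Let $U$ be a non-empty metric space and let $g:\mathbb{R}^d\times U\to\mathbb{R}^d$ be measurable and such that (Lipschitz) there is $L\ge 0$ with $\|g(y,u)-g(y',u)\|\le L\|y-y'\|$ for all $y,y'\in\mathbb{R}^d$, $u\in U$, and (linear growth) there is $a>0$ with $\|g(y,u)\|\le a(1+\|y\|)$ for all $(y,u)\in\mathbb{R}^d\times U$. Let $h:\mathbb{R}^d\to\mathbb{R}$ be a continuous function (so the cost does not depend on the control). Assume that there exists a compact set $N\subset\mathbb{R}^d$ which is forward invariant by the control system $y'(s)=g(y(s),u(s))$ (i.e. for every $y_0\in N$ and every control $u\in\mathcal{U}$, $y(t,u,y_0)\in N$ for all $t\ge 0$), and that $$\forall (y_1,y_2)\in N^2,\qquad \sup_{u\in U}\ \inf_{v\in U}\ \langle y_1-y_2,\ g(y_1,u)-g(y_2,v)\rangle\le 0 .$$ Then for every $y_0\in N$ the limit $V(y_0):=\lim_{t\to+\infty}V_t(y_0)$ exists, where $$V_t(y_0)=\inf_{u\in\mathcal{U}}\frac1t\int_0^t h(y(s,u,y_0))\,ds .$$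
   Context: $\mathcal{U}$ denotes the set of measurable functions (controls) $u:\mathbb{R}_+\to U$. For $y_0\in\mathbb{R}^d$ and $u\in\mathcal{U}$, $s\mapsto y(s,u,y_0)$ denotes the unique absolutely continuous solution on $\mathbb{R}_+$ of $y'(s)=g(y(s),u(s))$ for almost every $s\ge 0$, $y(0)=y_0$. $\langle\cdot,\cdot\rangle$ is the canonical scalar product of $\mathbb{R}^d$ and $\|\cdot\|$ the associated norm. *)

theory Defs
  imports "HOL-Analysis.Analysis"
begin

text \<open>The usual epsilon-delta definition; the members of \<^term>\<open>D\<close> are non-overlapping compact intervals.\<close>

definition absolutely_continuous_on :: "real set \<Rightarrow> (real \<Rightarrow> 'a::real_normed_vector) \<Rightarrow> bool" where
  "absolutely_continuous_on A f \<longleftrightarrow>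
    (\<forall>\<epsilon>>0. \<exists>\<delta>>0. \<forall>D S. D division_of S \<and> S \<subseteq> A \<and> (\<Sum>K\<in>D. Sup K - Inf K) < \<delta> \<longrightarrow>
       (\<Sum>K\<in>D. norm (f (Sup K) - f (Inf K))) < \<epsilon>)"

text \<open>Only the restriction of a control to the half-line \<^term>\<open>{0..} :: real set\<close> is relevant;
  measurability is from the Lebesgue sets to the Borel sets.\<close>

definition controls :: "(real \<Rightarrow> 'u::metric_space) set" where
  "controls = borel_measurable (lebesgue_on {0..})"

text \<open>As usual for Caratheodory solutions on an unbounded interval, absolute continuity is required
  on every compact subinterval.\<close>

definition is_solution ::
  "((real^'d) \<times> 'u \<Rightarrow> real^'d) \<Rightarrow> (real \<Rightarrow> 'u) \<Rightarrow> real^'d \<Rightarrow> (real \<Rightarrow> real^'d) \<Rightarrow> bool" where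
  "is_solution g u y\<^sub>0 y \<longleftrightarrow>
    (\<forall>T\<ge>0. absolutely_continuous_on {0..T} y) \<and>
    (AE s in lebesgue_on {0..}. (y has_vector_derivative g (y s, u s)) (at s within {0..})) \<and>
    y 0 = y\<^sub>0"

text \<open>The value at time \<^term>\<open>s\<close> of the unique solution. The description is pointwise because
  \<^const>\<open>is_solution\<close> leaves the values at negative times open; it is meaningful for
  \<^term>\<open>s \<ge> 0\<close> only.\<close>

definition trajectory ::
  "((real^'d) \<times> 'u \<Rightarrow> real^'d) \<Rightarrow> real \<Rightarrow> (real \<Rightarrow> 'u) \<Rightarrow> real^'d \<Rightarrow> real^'d" where
  "trajectory g s u y\<^sub>0 = (THE x. \<exists>y. is_solution g u y\<^sub>0 y \<and> y s = x)"

definition forward_invariant ::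
  "((real^'d) \<times> 'u::metric_space \<Rightarrow> real^'d) \<Rightarrow> (real^'d) set \<Rightarrow> bool" where
  "forward_invariant g N \<longleftrightarrow> (\<forall>y\<^sub>0\<in>N. \<forall>u\<in>controls. \<forall>t\<ge>0. trajectory g t u y\<^sub>0 \<in> N)"

definition value_function ::
  "((real^'d) \<times> 'u::metric_space \<Rightarrow> real^'d) \<Rightarrow> (real^'d \<Rightarrow> real) \<Rightarrow> real \<Rightarrow> real^'d \<Rightarrow> real" where
  "value_function g h t y\<^sub>0 =
    (INF u\<in>controls. 1 / t * integral {0..t} (\<lambda>s. h (trajectory g s u y\<^sub>0)))"

end

theory Submission
  imports Defs "HOL-Complex_Analysis.Great_Picard"
begin

text \<open>Two trajectories in \<^term>\<open>N\<close> can be kept from drifting apart, whichever control steers the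
first one. Over a short time step the state is frozen at \<open>y\<^sub>1, y\<^sub>2\<close>; since the difference under the
supremum splits into a term in \<open>u\<close> and a term in \<open>v\<close>, one constant \<open>v\<close> that nearly
maximises \<open>(y\<^sub>1 - y\<^sub>2) \<bullet> g (y\<^sub>2, v)\<close> answers every \<open>u\<close>. So a piecewise constant control tracks any
measurable one, and measurable selection is avoided (\<open>near_optimal_velocity\<close>, \<open>one_step_tracking\<close>,
\<open>tracking_control\<close>). Hence the functions \<open>V\<^sub>t\<close> with \<open>t > 0\<close> are equicontinuous on \<^term>\<open>N\<close>, because
\<open>h\<close> is evaluated at nearby points (\<open>value_functions_equicontinuous\<close>), and by Arzela-Ascoli every
sequence of times tending to infinity has a subsequence \<open>s\<^sub>n\<close> along which \<open>V\<close> converges uniformly on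
\<^term>\<open>N\<close> to some \<open>W\<close>.

Such a \<open>W\<close> is nondecreasing along trajectories: reaching \<open>z\<close> from \<open>y\<close> takes a fixed time, which a
long average does not see. Now cut a long trajectory from \<open>y\<close> into blocks of length \<open>T = s\<^sub>n\<close>.
On the block that starts at \<open>z\<close> the average cost is at least \<open>V\<^sub>T z\<close>, which is at least
\<open>W z - \<epsilon> \<ge> W y - \<epsilon>\<close>, so \<open>V\<^sub>t y\<close> is eventually at least \<open>W y - 2\<epsilon>\<close>
(\<open>uniform_limit_le_eventually\<close>). Each accumulation value of \<open>t \<mapsto> V\<^sub>t y\<close> at infinity is thus a lower bound
for all the others, and the limit exists.

The trajectories are specified through absolute continuity and almost everywhere differentiability.
The differential equation is first translated into its integral form
(\<open>is_solution_iff_integral_solution\<close>), by the differentiation theorem for indefinite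
integrals in one direction and the fundamental theorem of calculus for absolutely continuous
functions in the other. Existence and uniqueness are then proved for the integral form, by a
contraction argument in exponentially weighted sup norms.\<close>

section \<open>Absolutely continuous functions and indefinite integrals\<close>

lemma lipschitz_imp_absolutely_continuous:
  fixes f :: "real \<Rightarrow> 'a::real_normed_vector"
  assumes lip: "\<And>s t. \<lbrakk>s \<in> A; t \<in> A\<rbrakk> \<Longrightarrow> norm (f t - f s) \<le> C * \<bar>t - s\<bar>"
  shows "absolutely_continuous_on A f"
  unfolding absolutely_continuous_on_def
proof (intro allI impI)
  fix e :: real assume "e > 0"
  define B where "B = max C 1"
  have B: "B > 0" "C \<le> B" by (auto simp: B_def)
  have "(\<Sum>K\<in>D. norm (f (Sup K) - f (Inf K))) < e"
    if D: "D division_of S \<and> S \<subseteq> A \<and> (\<Sum>K\<in>D. Sup K - Inf K) < e / B" for D S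
  proof -
    have "(\<Sum>K\<in>D. norm (f (Sup K) - f (Inf K))) \<le> (\<Sum>K\<in>D. B * (Sup K - Inf K))"
    proof (rule sum_mono)
      fix K assume K: "K \<in> D"
      with D have "K \<noteq> {}" "K \<subseteq> A" "\<exists>a b. K = cbox a b"
        by (meson division_ofD order_trans)+
      then obtain a b where ab: "K = {a..b}" "a \<le> b" by auto
      then have "norm (f (Sup K) - f (Inf K)) \<le> C * \<bar>b - a\<bar>"
        using lip[of a b] \<open>K \<subseteq> A\<close> by (simp add: subset_iff)
      also have "\<dots> \<le> B * (b - a)"
        using ab B by (simp add: mult_right_mono)
      finally show "norm (f (Sup K) - f (Inf K)) \<le> B * (Sup K - Inf K)"
        using ab by simp
    qed
    also have "\<dots> = B * (\<Sum>K\<in>D. Sup K - Inf K)" by (simp add: sum_distrib_left)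
    also have "\<dots> < e" using D B by (simp add: field_simps)
    finally show ?thesis .
  qed
  then show "\<exists>\<delta>>0. \<forall>D S. D division_of S \<and> S \<subseteq> A \<and> (\<Sum>K\<in>D. Sup K - Inf K) < \<delta> \<longrightarrow>
       (\<Sum>K\<in>D. norm (f (Sup K) - f (Inf K))) < e"
    using \<open>e > 0\<close> B by (intro exI[of _ "e / B"]) auto
qed

text \<open>The gauge is the usual one at the points of differentiability, where Riemann sums of \<open>f'\<close> follow the
increments of \<open>f\<close>. At the points of the null set \<open>E\<close> it confines the intervals to an open set of
small measure; by absolute continuity the increments of \<open>f\<close> over those intervals have a small sum.\<close>

lemma has_integral_derivative_of_absolutely_continuous:
  fixes f :: "real \<Rightarrow> 'a::banach"
  assumes ab: "a \<le> b" and ac: "absolutely_continuous_on {a..b} f" and E: "negligible E"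
    and deriv: "\<And>x. x \<in> {a..b} - E \<Longrightarrow> (f has_vector_derivative f' x) (at x within {a..b})"
  shows "(f' has_integral f b - f a) {a..b}"
proof (rule has_integral_spike[OF E])
  \<comment> \<open>Changing the integrand to 0 on the null set leaves only the increments of \<open>f\<close> to be estimated there.\<close>
  define F where "F = (\<lambda>x. if x \<in> E then 0 else f' x)"
  show "f' x = F x" if "x \<in> {a..b} - E" for x using that by (simp add: F_def)
  show "(F has_integral f b - f a) {a..b}"
    unfolding has_integral_real
  proof (intro allI impI)
    fix e :: real assume e: "e > 0"
    define e0 where "e0 = e / (2 * (b - a + 1))"
    have e0: "e0 > 0" "e0 * (b - a) \<le> e / 2"
      using e ab by (auto simp: e0_def field_simps)
    obtain \<delta> where \<delta>: "\<delta> > 0"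
      and ac': "\<And>D S. D division_of S \<Longrightarrow> S \<subseteq> {a..b} \<Longrightarrow> (\<Sum>K\<in>D. Sup K - Inf K) < \<delta>
         \<Longrightarrow> (\<Sum>K\<in>D. norm (f (Sup K) - f (Inf K))) < e / 2"
      using ac e unfolding absolutely_continuous_on_def by (meson half_gt_zero)
    have Eleb: "E \<in> sets lebesgue" "measure lebesgue E = 0"
      using E negligible_imp_measurable negligible_imp_measure0 by blast+
    obtain T where T: "open T" "E \<subseteq> T" "T - E \<in> lmeasurable" "measure lebesgue (T - E) < \<delta>"
      using sets_lebesgue_outer_open[OF Eleb(1) \<delta>]
      by (metis emeasure_eq_measure2 ennreal_less_iff measure_nonneg)
    have Tm: "T \<in> lmeasurable" "measure lebesgue T < \<delta>"
    proof -
      have *: "T = (T - E) \<union> E" using T by auto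
      have El: "E \<in> lmeasurable" using E negligible_imp_measurable by blast
      show "T \<in> lmeasurable" using T(3) El * by (metis fmeasurable.Un)
      have "measure lebesgue T \<le> measure lebesgue (T - E) + measure lebesgue E"
        using * T(3) El measure_Un_le[of "T - E" lebesgue E] by (metis fmeasurableD)
      then show "measure lebesgue T < \<delta>" using T(4) Eleb by simp
    qed
    have "\<forall>x. \<exists>d>0. x \<in> {a..b} - E \<longrightarrow>
         (\<forall>y\<in>{a..b}. norm (y-x) < d \<longrightarrow> norm (f y - f x - (y-x) *\<^sub>R f' x) \<le> e0 * norm (y-x))"
      using deriv[unfolded has_vector_derivative_def has_derivative_within_alt] e0(1)
      by (metis zero_less_one)
    then obtain d where d: "\<And>x. 0 < d x"
      "\<And>x y. \<lbrakk>x \<in> {a..b} - E; y \<in> {a..b}; norm (y-x) < d x\<rbrakk>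
                        \<Longrightarrow> norm (f y - f x - (y-x) *\<^sub>R f' x) \<le> e0 * norm (y-x)"
      by metis
    define \<gamma> where "\<gamma> = (\<lambda>x. if x \<in> E then T else ball x (d x))"
    have "gauge \<gamma>" using T d(1) by (auto simp: gauge_def \<gamma>_def)
    moreover have "norm ((\<Sum>(x, K)\<in>p. measure lborel K *\<^sub>R F x) - (f b - f a)) < e"
      if p: "p tagged_division_of {a..b}" "\<gamma> fine p" for p
    proof -
      have fp: "finite p" using p by blast
      have ba: "b - a = (\<Sum>(x,K)\<in>p. Sup K - Inf K)" "f b - f a = (\<Sum>(x,K)\<in>p. f(Sup K) - f(Inf K))"
        using additive_tagged_division_1[where f= "\<lambda>x. x"] additive_tagged_division_1[where f= f] ab p
        by auto
      define q where "q = {z \<in> p. fst z \<in> E}"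
      have q: "q \<subseteq> p" "finite q" using fp by (auto simp: q_def)
      have shape: "\<exists>u v. K = {u..v} \<and> u \<le> v \<and> x \<in> {u..v} \<and> {u..v} \<subseteq> {a..b}"
        if "(x, K) \<in> p" for x K
      proof -
        have "x \<in> K" "K \<subseteq> {a..b}" "\<exists>u v. K = cbox u v" using p that by blast+
        then show ?thesis by auto
      qed
      have qpart: "q tagged_partial_division_of {a..b}"
        using p(1) q(1) by (meson tagged_division_of_def tagged_partial_division_subset)
      have qdiv: "snd ` q division_of \<Union>(snd ` q)"
        using qpart by (rule partial_division_of_tagged_division)
      have qT: "\<Union>(snd ` q) \<subseteq> T" 
        using p(2) q(1) by (fastforce simp: q_def fine_def \<gamma>_def)
      have qab: "\<Union>(snd ` q) \<subseteq> {a..b}" 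
        using shape q(1) by fastforce
      have "(\<Sum>K\<in>snd ` q. Sup K - Inf K) = (\<Sum>K\<in>snd ` q. measure lebesgue K)"
      proof (rule sum.cong)
        fix K assume "K \<in> snd ` q"
        then obtain x where "(x, K) \<in> p" using q(1) by auto
        from shape[OF this] show "Sup K - Inf K = measure lebesgue K" by auto
      qed simp
      also have "\<dots> = measure lebesgue (\<Union>(snd ` q))"
        using content_division[OF qdiv] .
      also have "\<dots> \<le> measure lebesgue T"
        using qT Tm qdiv by (intro measure_mono_fmeasurable) (auto simp: lmeasurable_division fmeasurableD)
      finally have "(\<Sum>K\<in>snd ` q. Sup K - Inf K) < \<delta>" using Tm by simp
      then have "(\<Sum>K\<in>snd ` q. norm (f (Sup K) - f (Inf K))) < e / 2"
        by (rule ac'[OF qdiv qab])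
      also have "(\<Sum>K\<in>snd ` q. norm (f (Sup K) - f (Inf K))) = (\<Sum>z\<in>q. norm (f (Sup (snd z)) - f (Inf (snd z))))"
      \<comment> \<open>One interval can carry several tags in \<open>q\<close> only if it is degenerate, and then its increment is 0.\<close>
      proof (subst sum.reindex_nontrivial)
        fix z w assume zw: "z \<in> q" "w \<in> q" "z \<noteq> w" "snd z = snd w"
        obtain x K y where xy: "z = (x, K)" "w = (y, K)" using zw(4) by (metis prod.collapse)
        then have "interior K \<inter> interior K = {}" 
          using zw tagged_partial_division_ofD(5)[OF qpart] by blast
        moreover obtain u v where "K = {u..v}" "u \<le> v" using shape zw(1) q(1) xy by blast
        ultimately have "Sup K = Inf K" by auto
        then show "norm (f (Sup (snd z)) - f (Inf (snd z))) = 0" using xy by simp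
      qed (auto simp: q(2))
      finally have bad: "(\<Sum>z\<in>q. norm (f (Sup (snd z)) - f (Inf (snd z)))) < e / 2" .
      have "norm ((\<Sum>(x, K)\<in>p. measure lborel K *\<^sub>R F x) - (f b - f a))
          = norm (\<Sum>(x, K)\<in>p. measure lborel K *\<^sub>R F x - (f(Sup K) - f(Inf K)))"
        by (simp add: ba(2) sum_subtractf case_prod_unfold)
      also have "\<dots> \<le> (\<Sum>(x, K)\<in>p. e0 * (Sup K - Inf K)
           + (if x \<in> E then norm (f (Sup K) - f (Inf K)) else 0))"
      proof (rule sum_norm_le, safe)
        fix x K assume xK: "(x, K) \<in> p"
        then obtain u v where K: "K = {u..v}" "u \<le> v" "x \<in> {u..v}" "{u..v} \<subseteq> {a..b}"
          using shape by blast
        show "norm (measure lborel K *\<^sub>R F x - (f (Sup K) - f (Inf K)))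
            \<le> e0 * (Sup K - Inf K) + (if x \<in> E then norm (f (Sup K) - f (Inf K)) else 0)"
        proof (cases "x \<in> E")
          case True then show ?thesis using K e0 by (simp add: F_def norm_minus_commute)
        next
          case False
          have "K \<subseteq> ball x (d x)" using p(2) xK False unfolding fine_def \<gamma>_def by fastforce
          moreover have "u \<in> K" "v \<in> K" using K by auto
          ultimately have uv: "norm (u - x) < d x" "norm (v - x) < d x"
            by (auto simp: dist_norm norm_minus_commute subset_iff)
          have xin: "x \<in> {a..b} - E" using K False by auto
          have "norm ((v - u) *\<^sub>R f' x - (f v - f u))
            = norm (f u - f x - (u - x) *\<^sub>R f' x - (f v - f x - (v - x) *\<^sub>R f' x))"
            by (auto simp: algebra_simps)
          also have "\<dots> \<le> norm (f u - f x - (u - x) *\<^sub>R f' x) + norm (f v - f x - (v - x) *\<^sub>R f' x)"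
            by (rule norm_triangle_ineq4)
          also have "\<dots> \<le> e0 * norm (u - x) + e0 * norm (v - x)"
            using K uv xin by (intro add_mono d(2)) auto
          also have "\<dots> = e0 * (v - u)"
            using K by (simp add: algebra_simps)
          finally show ?thesis using K False by (simp add: F_def)
        qed
      qed
      also have "\<dots> = e0 * (b - a) + (\<Sum>z\<in>p. if fst z \<in> E then norm (f (Sup (snd z)) - f (Inf (snd z))) else 0)"
        by (simp add: ba(1) sum.distrib sum_distrib_left case_prod_unfold)
      also have "(\<Sum>z\<in>p. if fst z \<in> E then norm (f (Sup (snd z)) - f (Inf (snd z))) else 0)
          = (\<Sum>z\<in>q. norm (f (Sup (snd z)) - f (Inf (snd z))))"
        unfolding q_def using fp by (simp add: sum.inter_filter)
      finally show ?thesis using bad e0(2) by linarith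
    qed
    ultimately show "\<exists>\<gamma>. gauge \<gamma> \<and> (\<forall>p. p tagged_division_of {a..b} \<and> \<gamma> fine p \<longrightarrow>
       norm ((\<Sum>(x, K)\<in>p. measure lborel K *\<^sub>R F x) - (f b - f a)) < e)"
      by (intro exI[of _ \<gamma>]) simp
  qed
qed

text \<open>The averages over \<open>{x..x+h}\<close> converge to \<open>f x\<close> almost everywhere. The form without division also
makes sense as a bound for increments, to be applied to the reflected function as well.\<close>

lemma indefinite_integral_right_differentiable:
  fixes f :: "real \<Rightarrow> 'a::euclidean_space"
  assumes "\<And>a b. f integrable_on {a..b}"
  obtains E where "negligible E"
    "\<And>x e. \<lbrakk>x \<notin> E; 0 < e\<rbrakk> \<Longrightarrow>
       \<exists>d>0. \<forall>h. 0 < h \<and> h < d \<longrightarrow> norm (integral {x..x+h} f - h *\<^sub>R f x) \<le> e * h"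
proof -
  obtain E where E: "negligible E"
    "\<And>x e. \<lbrakk>x \<notin> E; 0 < e\<rbrakk> \<Longrightarrow> \<exists>d>0. \<forall>h. 0 < h \<and> h < d \<longrightarrow>
        norm (integral {x..x + h} f /\<^sub>R h - f x) < e"
    using integrable_ccontinuous_explicit[of f] assms by auto
  have "norm (integral {x..x+h} f - h *\<^sub>R f x) \<le> e * h"
    if "0 < h" "norm (integral {x..x + h} f /\<^sub>R h - f x) < e" for x h e
  proof -
    have "integral {x..x+h} f - h *\<^sub>R f x = h *\<^sub>R (integral {x..x + h} f /\<^sub>R h - f x)"
      using that by (simp add: scaleR_diff_right)
    then have "norm (integral {x..x+h} f - h *\<^sub>R f x) = h * norm (integral {x..x + h} f /\<^sub>R h - f x)"
      using that by simp
    then show ?thesis using that by (simp add: mult.commute)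
  qed
  then show thesis using E by (intro that[of E]) (auto, metis)
qed

text \<open>Lebesgue's differentiation theorem: the left-hand derivative is the right-hand derivative of the
reflected integrand.\<close>

lemma AE_indefinite_integral_has_vector_derivative:
  fixes f :: "real \<Rightarrow> 'a::euclidean_space"
  assumes int: "\<And>T. T \<ge> 0 \<Longrightarrow> f integrable_on {0..T}"
  shows "AE s in lebesgue_on {0..}.
    ((\<lambda>t. integral {0..t} f) has_vector_derivative f s) (at s within {0..})"
proof -
  define F where "F = (\<lambda>x. if x \<in> {0..} then f x else 0)"
  have Fint: "F integrable_on {a..b}" for a b
  proof -
    have "f integrable_on {max 0 a..b}"
      by (rule integrable_on_subinterval[OF int[of "\<bar>b\<bar>"]]) auto
    moreover have "{0..} \<inter> {a..b} = {max 0 a..b}" by auto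
    ultimately show ?thesis
      unfolding F_def by (simp only: integrable_restrict_Int)
  qed
  obtain E1 where E1: "negligible E1"
    "\<And>x e. \<lbrakk>x \<notin> E1; 0 < e\<rbrakk> \<Longrightarrow>
       \<exists>d>0. \<forall>h. 0 < h \<and> h < d \<longrightarrow> norm (integral {x..x+h} F - h *\<^sub>R F x) \<le> e * h"
    using indefinite_integral_right_differentiable[of F] Fint by blast
  have "(\<lambda>x. F (-x)) integrable_on {a..b}" for a b
    using Fint[of "-b" "-a"] Henstock_Kurzweil_Integration.integrable_reflect_real[where f=F and a="-b" and b="-a"] by simp
  then obtain E2 where E2: "negligible E2"
    "\<And>x e. \<lbrakk>x \<notin> E2; 0 < e\<rbrakk> \<Longrightarrow>
       \<exists>d>0. \<forall>h. 0 < h \<and> h < d \<longrightarrow> norm (integral {x..x+h} (\<lambda>x. F (-x)) - h *\<^sub>R F (-x)) \<le> e * h"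
    using indefinite_integral_right_differentiable[of "\<lambda>x. F (-x)"] by blast
  define E where "E = E1 \<union> uminus ` E2"
  have E: "negligible E"
  proof -
    have "negligible (uminus ` E2)"
    proof (rule negligible_locally_Lipschitz_image[OF _ E2(1)])
      show "\<exists>T B. open T \<and> x \<in> T \<and> (\<forall>y\<in>E2 \<inter> T. norm (- y - - x) \<le> B * norm (y - x))" for x
        by (rule exI[of _ UNIV], rule exI[of _ 1]) (auto simp: abs_minus_commute)
    qed simp
    then show ?thesis unfolding E_def using E1(1) by (rule negligible_Un[rotated])
  qed
  have deriv: "((\<lambda>t. integral {0..t} f) has_vector_derivative f s) (at s within {0..})"
    if s: "s \<in> {0..} - E" for s
    unfolding has_vector_derivative_def has_derivative_within_alt
  proof (intro conjI allI impI)
    show "bounded_linear (\<lambda>x. x *\<^sub>R f s)" by (simp add: bounded_linear_scaleR_left)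
    fix e :: real assume e: "e > 0"
    have Fs: "F s = f s" using s by (simp add: F_def)
    have sE: "s \<notin> E1" "- s \<notin> E2" using s by (auto simp: E_def image_iff)
    obtain d1 where d1: "d1 > 0" 
      "\<And>h. 0 < h \<Longrightarrow> h < d1 \<Longrightarrow> norm (integral {s..s+h} F - h *\<^sub>R f s) \<le> e * h"
      using E1(2)[OF sE(1) e] Fs by auto
    obtain d2 where d2: "d2 > 0" 
      "\<And>h. 0 < h \<Longrightarrow> h < d2 \<Longrightarrow> norm (integral {-s..-s+h} (\<lambda>x. F (-x)) - h *\<^sub>R f s) \<le> e * h"
      using E2(2)[OF sE(2) e] Fs by auto
    have eqF: "integral {0..t} f = integral {0..t} F" for t
      by (rule integral_cong) (auto simp: F_def)
    have comb: "integral {0..t} F = integral {0..r} F + integral {r..t} F" if "0 \<le> r" "r \<le> t" for r t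
      using that Fint by (simp add: Henstock_Kurzweil_Integration.integral_combine)
    have refl: "integral {-r..-t} (\<lambda>x. F (-x)) = integral {t..r} F" for r t
      by (rule Henstock_Kurzweil_Integration.integral_reflect_real)
    have "norm (integral {0..y} f - integral {0..s} f - (y - s) *\<^sub>R f s) \<le> e * norm (y - s)"
      if y: "y \<ge> 0" "norm (y - s) < min d1 d2" for y
    proof (cases y s rule: linorder_cases)
      case greater
      then have "integral {0..y} f - integral {0..s} f = integral {s..s + (y - s)} F"
        using s comb[of s y] by (simp add: eqF)
      then show ?thesis using d1(2)[of "y - s"] greater y by (simp add: dist_norm)
    next
      case equal then show ?thesis by simp
    next
      case less
      then have "integral {0..s} f - integral {0..y} f = integral {-s..-s + (s - y)} (\<lambda>x. F (-x))"
        using y comb[of y s] refl[of s y] by (simp add: eqF)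
      moreover have "norm (integral {0..y} f - integral {0..s} f - (y - s) *\<^sub>R f s)
        = norm (integral {0..s} f - integral {0..y} f - (s - y) *\<^sub>R f s)"
        by (subst norm_minus_cancel[symmetric]) (simp add: algebra_simps)
      ultimately show ?thesis using d2(2)[of "s - y"] less y by (simp add: abs_minus_commute)
    qed
    then show "\<exists>d>0. \<forall>y\<in>{0..}. norm (y - s) < d \<longrightarrow>
        norm (integral {0..y} f - integral {0..s} f - (y - s) *\<^sub>R f s) \<le> e * norm (y - s)"
      using d1(1) d2(1) by (intro exI[of _ "min d1 d2"]) auto
  qed
  have "E \<in> null_sets lebesgue" using E by (simp add: negligible_iff_null_sets)
  then have "AE s in lebesgue. s \<notin> E" by (rule AE_not_in)
  then show ?thesis
    using deriv by (subst AE_restrict_space_iff) auto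
qed

section \<open>Calculus on the half-line\<close>

lemma has_integral_exp:
  fixes c :: real
  assumes "c > 0" "t \<ge> 0"
  shows "((\<lambda>s. exp (c * s)) has_integral (exp (c * t) - 1) / c) {0..t}"
proof -
  have "((\<lambda>s. exp (c * s)) has_integral exp (c * t) / c - exp (c * 0) / c) {0..t}"
    using assms
    by (intro fundamental_theorem_of_calculus)
       (auto intro!: derivative_eq_intros simp flip: has_real_derivative_iff_has_vector_derivative)
  then show ?thesis by (simp add: diff_divide_distrib)
qed

lemma continuous_on_halfline:
  fixes f :: "real \<Rightarrow> 'a::metric_space"
  assumes "\<And>T. T \<ge> 0 \<Longrightarrow> continuous_on {0..T} f"
  shows "continuous_on {0..} f"
  unfolding continuous_on_iff
proof (intro ballI allI impI)
  fix x e :: real assume x: "x \<in> {0..}" and "e > 0"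
  with assms[of "x + 1"] obtain d where "d > 0"
    "\<And>y. y \<in> {0..x+1} \<Longrightarrow> dist y x < d \<Longrightarrow> dist (f y) (f x) < e"
    unfolding continuous_on_iff by force
  then show "\<exists>d>0. \<forall>x'\<in>{0..}. dist x' x < d \<longrightarrow> dist (f x') (f x) < e"
    by (intro exI[of _ "min d 1"]) (auto simp: dist_real_def)
qed

lemma continuous_on_halfline_bounded:
  fixes f :: "real \<Rightarrow> 'a::real_normed_vector"
  assumes "continuous_on {0..} f"
  obtains B where "\<And>s. s \<in> {0..T} \<Longrightarrow> norm (f s) \<le> B"
proof -
  have "bounded (f ` {0..T})"
    using assms by (intro compact_imp_bounded compact_continuous_image)
      (auto intro: continuous_on_subset)
  then show thesis using that unfolding bounded_iff by blast
qed

section \<open>Controls\<close>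

text \<open>Extending a control by a constant replaces measurability on the half-line by measurability on the
whole line, where translation is measurable.\<close>

lemma controls_iff_extension:
  fixes u :: "real \<Rightarrow> 'u::metric_space"
  shows "u \<in> controls \<longleftrightarrow> (\<lambda>s. if s \<in> {0..} then u s else c) \<in> borel_measurable lebesgue"
  unfolding controls_def by (rule measurable_restrict_space_iff) auto

lemma const_in_controls: "(\<lambda>s. c) \<in> controls"
  by (simp add: controls_def)

lemma measurable_lebesgue_translation: "(\<lambda>s::real. s + c) \<in> lebesgue \<rightarrow>\<^sub>M lebesgue"
  using lebesgue_affine_measurable[of "\<lambda>_. 1" c] by (simp add: add.commute)

lemma shift_in_controls:
  assumes "u \<in> controls" "\<tau> \<ge> 0"
  shows "(\<lambda>s. u (s + \<tau>)) \<in> controls"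
proof -
  let ?c = "u 0"
  have "(\<lambda>s. if s \<in> {0..} then u s else ?c) \<in> borel_measurable lebesgue"
    using assms controls_iff_extension by blast
  from measurable_compose[OF measurable_lebesgue_translation[of \<tau>] this]
  have "(\<lambda>s. if s + \<tau> \<in> {0..} then u (s + \<tau>) else ?c) \<in> borel_measurable lebesgue" .
  then have "(\<lambda>s. if s \<in> {0..} then (if s + \<tau> \<in> {0..} then u (s + \<tau>) else ?c) else ?c)
      \<in> borel_measurable lebesgue"
    by (rule measurable_If) auto
  moreover have "(\<lambda>s. if s \<in> {0..} then (if s + \<tau> \<in> {0..} then u (s + \<tau>) else ?c) else ?c)
    = (\<lambda>s. if s \<in> {0..} then u (s + \<tau>) else ?c)" using assms(2) by auto
  ultimately show ?thesis using controls_iff_extension[of "\<lambda>s. u (s + \<tau>)" ?c] by simp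
qed

definition switch_control :: "real \<Rightarrow> (real \<Rightarrow> 'u) \<Rightarrow> (real \<Rightarrow> 'u) \<Rightarrow> real \<Rightarrow> 'u" where
  "switch_control \<tau> u v = (\<lambda>s. if s < \<tau> then u s else v (s - \<tau>))"

lemma switch_in_controls:
  assumes "u \<in> controls" "v \<in> controls" "\<tau> \<ge> 0"
  shows "switch_control \<tau> u v \<in> controls"
proof -
  let ?c = "u 0"
  have u: "(\<lambda>s. if s \<in> {0..} then u s else ?c) \<in> borel_measurable lebesgue"
    and v: "(\<lambda>s. if s \<in> {0..} then v s else ?c) \<in> borel_measurable lebesgue"
    using assms controls_iff_extension by blast+
  have "(\<lambda>s. if s + - \<tau> \<in> {0..} then v (s + - \<tau>) else ?c) \<in> borel_measurable lebesgue"
    using measurable_compose[OF measurable_lebesgue_translation[of "- \<tau>"] v] .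
  from measurable_If[OF u this, of "\<lambda>s. s < \<tau>"]
  have "(\<lambda>s. if s < \<tau> then if s \<in> {0..} then u s else ?c
      else if s + - \<tau> \<in> {0..} then v (s + - \<tau>) else ?c) \<in> borel_measurable lebesgue"
    by simp
  moreover have "(\<lambda>s. if s < \<tau> then if s \<in> {0..} then u s else ?c
      else if s + - \<tau> \<in> {0..} then v (s + - \<tau>) else ?c)
    = (\<lambda>s. if s \<in> {0..} then switch_control \<tau> u v s else ?c)"
    using assms(3) by (auto simp: switch_control_def)
  ultimately show ?thesis using controls_iff_extension[of "switch_control \<tau> u v" ?c] by simp
qed

section \<open>Well-posedness\<close>

text \<open>For these systems every control and every initial state determine exactly one trajectory, and
trajectories can be restarted and concatenated.\<close>

locale control_system =
  fixes g :: "(real^'d) \<times> 'u::metric_space \<Rightarrow> real^'d" and L a :: real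
  assumes g_measurable: "g \<in> borel_measurable (borel \<Otimes>\<^sub>M borel)"
    and L_nonneg: "0 \<le> L"
    and g_lipschitz: "norm (g (y, u) - g (y', u)) \<le> L * norm (y - y')"
    and a_pos: "0 < a"
    and g_growth: "norm (g (y, u)) \<le> a * (1 + norm y)"
begin

text \<open>The Henstock-Kurzweil integral makes integrability of the velocity part of the assertion.\<close>

definition integral_solution :: "(real \<Rightarrow> 'u) \<Rightarrow> real^'d \<Rightarrow> (real \<Rightarrow> real^'d) \<Rightarrow> bool" where
  "integral_solution u y\<^sub>0 y \<longleftrightarrow>
     (\<forall>t\<ge>0. ((\<lambda>s. g (y s, u s)) has_integral (y t - y\<^sub>0)) {0..t})"

lemma velocity_integrable:
  assumes u: "u \<in> controls" and y: "continuous_on {0..} y" and "T \<ge> 0"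
  shows "(\<lambda>s. g (y s, u s)) integrable_on {0..T}"
proof -
  have "y \<in> borel_measurable (lebesgue_on {0..})"
    using y by (rule continuous_imp_measurable_on_sets_lebesgue) simp
  then have "(\<lambda>s. (y s, u s)) \<in> lebesgue_on {0..} \<rightarrow>\<^sub>M borel \<Otimes>\<^sub>M borel"
    using u by (intro measurable_Pair) (auto simp: controls_def)
  then have "(\<lambda>s. g (y s, u s)) \<in> borel_measurable (lebesgue_on {0..})"
    using g_measurable by (rule measurable_compose)
  then have meas: "(\<lambda>s. g (y s, u s)) \<in> borel_measurable (lebesgue_on {0..T})"
    by (rule measurable_restrict_mono) auto
  obtain B where B: "\<And>s. s \<in> {0..T} \<Longrightarrow> norm (y s) \<le> B"
    using continuous_on_halfline_bounded[OF y] by blast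
  have "norm (g (y s, u s)) \<le> a * (1 + B)" if "s \<in> {0..T}" for s
  proof -
    have "norm (g (y s, u s)) \<le> a * (1 + norm (y s))" by (rule g_growth)
    also have "\<dots> \<le> a * (1 + B)" using B[OF that] a_pos by simp
    finally show ?thesis .
  qed
  then show ?thesis
    by (intro measurable_bounded_by_integrable_imp_integrable[OF meas, of "\<lambda>_. a * (1 + B)"]) auto
qed

lemma integral_solution_eq:
  assumes "integral_solution u y\<^sub>0 y" "t \<ge> 0"
  shows "y t = y\<^sub>0 + integral {0..t} (\<lambda>s. g (y s, u s))"
  using assms integral_unique[of "\<lambda>s. g (y s, u s)" "y t - y\<^sub>0" "{0..t}"]
  by (simp add: integral_solution_def)

lemma integral_solution_integrable:
  assumes "integral_solution u y\<^sub>0 y" "T \<ge> 0"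
  shows "(\<lambda>s. g (y s, u s)) integrable_on {0..T}"
  using assms by (auto simp: integral_solution_def)

lemma integral_solution_continuous:
  assumes "integral_solution u y\<^sub>0 y"
  shows "continuous_on {0..} y"
proof (rule continuous_on_halfline)
  fix T :: real assume "T \<ge> 0"
  have "continuous_on {0..T} (\<lambda>t. y\<^sub>0 + integral {0..t} (\<lambda>s. g (y s, u s)))"
    using integral_solution_integrable[OF assms \<open>T \<ge> 0\<close>]
    by (intro continuous_intros indefinite_integral_continuous_1)
  then show "continuous_on {0..T} y"
    by (rule continuous_on_eq) (simp add: integral_solution_eq[OF assms])
qed

lemma integral_solution_increment:
  assumes sol: "integral_solution u y\<^sub>0 y" and "0 \<le> s" "s \<le> t"
  shows "((\<lambda>r. g (y r, u r)) has_integral (y t - y s)) {s..t}"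
proof -
  have int: "(\<lambda>r. g (y r, u r)) integrable_on {0..t}"
    using assms integral_solution_integrable by auto
  then have "(\<lambda>r. g (y r, u r)) integrable_on {s..t}"
    by (rule integrable_on_subinterval) (use assms in auto)
  moreover have "integral {0..s} (\<lambda>r. g (y r, u r)) + integral {s..t} (\<lambda>r. g (y r, u r))
      = integral {0..t} (\<lambda>r. g (y r, u r))"
    using assms int by (intro Henstock_Kurzweil_Integration.integral_combine)
  ultimately show ?thesis
    using assms integral_solution_eq[OF sol, of s] integral_solution_eq[OF sol, of t]
    by (simp add: has_integral_iff algebra_simps)
qed

text \<open>Linear growth bounds the velocity wherever the state is bounded by \<open>B\<close>.\<close>

lemma integral_solution_lipschitz:
  assumes sol: "integral_solution u y\<^sub>0 y"
    and B: "\<And>s. s \<in> {0..T} \<Longrightarrow> norm (y s) \<le> B"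
    and st: "s \<in> {0..T}" "t \<in> {0..T}"
  shows "norm (y t - y s) \<le> a * (1 + B) * \<bar>t - s\<bar>"
proof -
  have *: "norm (y t - y s) \<le> a * (1 + B) * (t - s)" if "0 \<le> s" "s \<le> t" "t \<le> T" for s t
  proof -
    have "0 \<le> B" using order_trans[OF norm_ge_zero B[OF st(1)]] .
    then have B0: "0 \<le> a * (1 + B)" using a_pos by simp
    have bd: "norm (g (y r, u r)) \<le> a * (1 + B)" if "r \<in> {0..T}" for r
    proof -
      have "norm (g (y r, u r)) \<le> a * (1 + norm (y r))" by (rule g_growth)
      also have "\<dots> \<le> a * (1 + B)" using B[OF that] a_pos by simp
      finally show ?thesis .
    qed
    have "norm (y t - y s) \<le> a * (1 + B) * measure lborel {s..t}"
      by (rule has_integral_bound_real[OF B0 _ integral_solution_increment[OF sol that(1,2)], of "{}"])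
         (use bd that in auto)
    then show ?thesis using that by simp
  qed
  show ?thesis
    using *[of s t] *[of t s] st by (cases "s \<le> t") (auto simp: norm_minus_commute)
qed

lemma is_solution_iff_integral_solution: "is_solution g u y\<^sub>0 y \<longleftrightarrow> integral_solution u y\<^sub>0 y"
proof
  assume sol: "integral_solution u y\<^sub>0 y"
  have "absolutely_continuous_on {0..T} y" if "T \<ge> 0" for T
  proof -
    obtain B where "\<And>s. s \<in> {0..T} \<Longrightarrow> norm (y s) \<le> B"
      using continuous_on_halfline_bounded[OF integral_solution_continuous[OF sol]] by blast
    then show ?thesis
      by (intro lipschitz_imp_absolutely_continuous) (rule integral_solution_lipschitz[OF sol])
  qed
  moreover have "AE s in lebesgue_on {0..}.
      (y has_vector_derivative g (y s, u s)) (at s within {0..})"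
  proof (rule AE_mp[OF AE_indefinite_integral_has_vector_derivative AE_I2], rule integral_solution_integrable[OF sol], assumption, rule impI)
    fix s :: real assume s: "s \<in> space (lebesgue_on {0..})"
      and "((\<lambda>t. integral {0..t} (\<lambda>s. g (y s, u s))) has_vector_derivative g (y s, u s)) (at s within {0..})"
    then have "((\<lambda>t. y\<^sub>0 + integral {0..t} (\<lambda>s. g (y s, u s))) has_vector_derivative g (y s, u s)) (at s within {0..})"
      by (auto intro!: derivative_eq_intros)
    then show "(y has_vector_derivative g (y s, u s)) (at s within {0..})"
      by (rule has_vector_derivative_transform[rotated 2])
         (use s integral_solution_eq[OF sol] in auto)
  qed
  moreover have "y 0 = y\<^sub>0" using integral_solution_eq[OF sol, of 0] by simp
  ultimately show "is_solution g u y\<^sub>0 y" by (simp add: is_solution_def)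
next
  assume sol: "is_solution g u y\<^sub>0 y"
  then have "AE s in lebesgue. s \<in> {0..} \<longrightarrow> (y has_vector_derivative g (y s, u s)) (at s within {0..})"
    by (simp add: is_solution_def AE_restrict_space_iff)
  then obtain E where E: "E \<in> null_sets lebesgue"
    "{s. \<not> (s \<in> {0..} \<longrightarrow> (y has_vector_derivative g (y s, u s)) (at s within {0..}))} \<subseteq> E"
    by (auto simp: eventually_ae_filter)
  have "((\<lambda>s. g (y s, u s)) has_integral (y t - y 0)) {0..t}" if "t \<ge> 0" for t
  proof (rule has_integral_derivative_of_absolutely_continuous)
    show "negligible E" using E by (simp add: negligible_iff_null_sets)
    show "absolutely_continuous_on {0..t} y" using sol that by (simp add: is_solution_def)
    fix s assume "s \<in> {0..t} - E"
    then have "(y has_vector_derivative g (y s, u s)) (at s within {0..})" using E by auto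
    then show "(y has_vector_derivative g (y s, u s)) (at s within {0..t})"
      by (rule has_vector_derivative_within_subset) auto
  qed (use that in auto)
  then show "integral_solution u y\<^sub>0 y"
    using sol by (simp add: integral_solution_def is_solution_def)
qed

text \<open>The difference of two solutions is measured by the maximum \<open>M\<close> over \<open>{0..T}\<close> of the weighted norm
with weight \<open>exp (- c * s)\<close>. Inserting this bound into the integral equation gives
\<open>M \<le> L / c * M\<close>, hence \<open>M = 0\<close> as soon as \<open>c > L\<close>.\<close>

lemma integral_solution_unique:
  assumes y: "integral_solution u y\<^sub>0 y" and z: "integral_solution u y\<^sub>0 z" and "T \<ge> 0"
  shows "y T = z T"
proof -
  define c where "c = L + 1"
  have c: "c > 0" "L < c" using L_nonneg by (auto simp: c_def)
  define \<phi> where "\<phi> = (\<lambda>s. exp (- c * s) * norm (y s - z s))"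
  have "continuous_on {0..T} \<phi>"
    using integral_solution_continuous[OF y] integral_solution_continuous[OF z]
    unfolding \<phi>_def by (intro continuous_intros) (auto intro: continuous_on_subset)
  then obtain s\<^sub>0 where s0: "s\<^sub>0 \<in> {0..T}" and max: "\<And>s. s \<in> {0..T} \<Longrightarrow> \<phi> s \<le> \<phi> s\<^sub>0"
    using continuous_attains_sup[of "{0..T}" \<phi>] \<open>T \<ge> 0\<close> by auto
  define M where "M = \<phi> s\<^sub>0"
  have M: "M \<ge> 0" by (simp add: M_def \<phi>_def)
  have bd: "norm (y s - z s) \<le> M * exp (c * s)" if "s \<in> {0..T}" for s
    using max[OF that] by (simp add: M_def \<phi>_def exp_minus field_simps)
  have iy: "(\<lambda>s. g (y s, u s)) integrable_on {0..s\<^sub>0}" and iz: "(\<lambda>s. g (z s, u s)) integrable_on {0..s\<^sub>0}"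
    using integral_solution_integrable[OF y] integral_solution_integrable[OF z] s0 by auto
  have E: "((\<lambda>s. L * M * exp (c * s)) has_integral L * M * ((exp (c * s\<^sub>0) - 1) / c)) {0..s\<^sub>0}"
    using has_integral_exp[OF c(1), of s\<^sub>0] s0 by (intro has_integral_mult_right) auto
  have "y s\<^sub>0 - z s\<^sub>0 = integral {0..s\<^sub>0} (\<lambda>s. g (y s, u s) - g (z s, u s))"
    using s0 iy iz by (simp add: integral_solution_eq[OF y] integral_solution_eq[OF z] Henstock_Kurzweil_Integration.integral_diff)
  also have "norm \<dots> \<le> integral {0..s\<^sub>0} (\<lambda>s. L * M * exp (c * s))"
  proof (rule Henstock_Kurzweil_Integration.integral_norm_bound_integral)
    fix s assume s: "s \<in> {0..s\<^sub>0}"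
    have "norm (g (y s, u s) - g (z s, u s)) \<le> L * norm (y s - z s)" by (rule g_lipschitz)
    also have "\<dots> \<le> L * (M * exp (c * s))"
      using bd[of s] s s0 L_nonneg by (intro mult_left_mono) auto
    finally show "norm (g (y s, u s) - g (z s, u s)) \<le> L * M * exp (c * s)" by simp
  qed (use iy iz E in \<open>auto intro: Henstock_Kurzweil_Integration.integrable_diff\<close>)
  also have "\<dots> = L * M * ((exp (c * s\<^sub>0) - 1) / c)" using E by (rule integral_unique)
  also have "\<dots> \<le> L * M * (exp (c * s\<^sub>0) / c)"
    using L_nonneg M c by (intro mult_left_mono divide_right_mono) auto
  finally have "norm (y s\<^sub>0 - z s\<^sub>0) \<le> L * M * (exp (c * s\<^sub>0) / c)" .
  moreover have "norm (y s\<^sub>0 - z s\<^sub>0) = M * exp (c * s\<^sub>0)"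
    by (simp add: M_def \<phi>_def exp_minus)
  ultimately have "(c * M) * exp (c * s\<^sub>0) \<le> (L * M) * exp (c * s\<^sub>0)"
    using c by (simp add: field_simps)
  then have "c * M \<le> L * M" by (rule mult_right_le_imp_le) simp
  then have "M = 0" using c M by (smt (verit) mult_right_less_imp_less mult_right_cancel)
  then show ?thesis using bd[of T] \<open>T \<ge> 0\<close> by simp
qed

text \<open>A solution grows at most exponentially, so it is sought as \<open>y t = exp (c * t) *\<^sub>R z t\<close> with \<open>z\<close>
bounded and continuous. For \<open>z\<close> the integral equation becomes a fixed point equation \<open>\<Phi> z = z\<close>
whose Lipschitz constant in the sup norm is \<open>L / c < 1\<close>, which yields a solution for all times at
once.\<close>

lemma integral_solution_exists:
  assumes u: "u \<in> controls"
  shows "\<exists>y. integral_solution u y\<^sub>0 y"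
proof -
  define c where "c = L + 1"
  have c: "c > 0" "0 \<le> L / c" "L / c < 1" using L_nonneg by (auto simp: c_def)
  define S where "S = (\<lambda>z t. y\<^sub>0 + integral {0..t} (\<lambda>s. g (exp (c * s) *\<^sub>R z s, u s)))"
  \<comment> \<open>The functions in \<open>bcontfun\<close> live on the whole line, so the values at negative times are frozen at the value at 0.\<close>
  define \<Phi> where "\<Phi> = (\<lambda>z t. exp (- c * max t 0) *\<^sub>R S z (max t 0))"
  have int: "(\<lambda>s. g (exp (c * s) *\<^sub>R z s, u s)) integrable_on {0..T}"
    if "continuous_on UNIV z" "T \<ge> 0" for z T
    using that by (intro velocity_integrable[OF u])
      (auto intro!: continuous_intros intro: continuous_on_subset)
  have \<Phi>_bcontfun: "\<Phi> z \<in> bcontfun" if z: "z \<in> bcontfun" for z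
  proof -
    from z obtain B where cz: "continuous_on UNIV z" and B: "\<And>x. norm (z x) \<le> B"
      by (auto simp: bcontfun_def bounded_iff)
    have B0: "B \<ge> 0" using B[of 0] norm_ge_zero order_trans by blast
    have "continuous_on {0..} (S z)"
    proof (rule continuous_on_halfline)
      fix T :: real assume "T \<ge> 0"
      then show "continuous_on {0..T} (S z)"
        unfolding S_def by (intro continuous_intros indefinite_integral_continuous_1 int[OF cz])
    qed
    then have "continuous_on UNIV (\<lambda>t. S z (max t 0))"
      by (rule continuous_on_compose2) (auto intro!: continuous_intros)
    then have "continuous_on UNIV (\<Phi> z)"
      unfolding \<Phi>_def by (intro continuous_intros)
    moreover have "norm (\<Phi> z t) \<le> norm y\<^sub>0 + a * (1 + B) / c" for t
    proof -
      define r where "r = max t 0"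
      have r: "r \<ge> 0" by (simp add: r_def)
      have E: "((\<lambda>s. a * (1 + B) * exp (c * s)) has_integral a * (1 + B) * ((exp (c * r) - 1) / c)) {0..r}"
        using has_integral_exp[OF c(1) r] by (intro has_integral_mult_right)
      have "norm (integral {0..r} (\<lambda>s. g (exp (c * s) *\<^sub>R z s, u s)))
          \<le> integral {0..r} (\<lambda>s. a * (1 + B) * exp (c * s))"
      proof (rule Henstock_Kurzweil_Integration.integral_norm_bound_integral)
        fix s assume s: "s \<in> {0..r}"
        have e1: "exp (c * s) \<ge> 1" using s c by simp
        have "norm (g (exp (c * s) *\<^sub>R z s, u s)) \<le> a * (1 + norm (exp (c * s) *\<^sub>R z s))"
          by (rule g_growth)
        also have "\<dots> \<le> a * (exp (c * s) + exp (c * s) * B)"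
          using a_pos e1 B[of s] by (intro mult_left_mono add_mono) auto
        finally show "norm (g (exp (c * s) *\<^sub>R z s, u s)) \<le> a * (1 + B) * exp (c * s)"
          by (simp add: algebra_simps)
      qed (use E int[OF cz r] in auto)
      also have "\<dots> = a * (1 + B) * ((exp (c * r) - 1) / c)" using E by (rule integral_unique)
      also have "\<dots> \<le> a * (1 + B) * (exp (c * r) / c)"
        using a_pos B0 c by (intro mult_left_mono divide_right_mono) auto
      finally have "norm (S z r) \<le> norm y\<^sub>0 + a * (1 + B) * (exp (c * r) / c)"
        unfolding S_def by (meson add_left_mono norm_triangle_ineq order_trans)
      moreover have "norm y\<^sub>0 * 1 \<le> norm y\<^sub>0 * exp (c * r)"
        using r c by (intro mult_left_mono) auto
      ultimately have "norm (S z r) \<le> (norm y\<^sub>0 + a * (1 + B) / c) * exp (c * r)"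
        by (simp add: algebra_simps)
      then have "exp (- c * r) * norm (S z r) \<le> norm y\<^sub>0 + a * (1 + B) / c"
        by (simp add: exp_minus field_simps)
      then show ?thesis by (simp add: \<Phi>_def r_def)
    qed
    ultimately show ?thesis by (rule bcontfun_normI)
  qed
  have app: "apply_bcontfun (Bcontfun (\<Phi> (apply_bcontfun z))) = \<Phi> (apply_bcontfun z)" for z
    by (intro Bcontfun_inverse \<Phi>_bcontfun apply_bcontfun)
  have "dist (Bcontfun (\<Phi> (apply_bcontfun z))) (Bcontfun (\<Phi> (apply_bcontfun w))) \<le> L / c * dist z w" for z w
  proof (rule dist_bound)
    fix t :: real
    define r where "r = max t 0"
    have r: "r \<ge> 0" by (simp add: r_def)
    define D where "D = dist z w"
    have D: "norm (apply_bcontfun z s - apply_bcontfun w s) \<le> D" for s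
      unfolding D_def using dist_bounded[of z s w] by (simp add: dist_norm)
    have D0: "D \<ge> 0" by (simp add: D_def)
    have iz: "(\<lambda>s. g (exp (c * s) *\<^sub>R apply_bcontfun z s, u s)) integrable_on {0..r}"
      and iw: "(\<lambda>s. g (exp (c * s) *\<^sub>R apply_bcontfun w s, u s)) integrable_on {0..r}"
      using r by (auto intro!: int)
    have E: "((\<lambda>s. L * D * exp (c * s)) has_integral L * D * ((exp (c * r) - 1) / c)) {0..r}"
      using has_integral_exp[OF c(1) r] by (intro has_integral_mult_right)
    have "S (apply_bcontfun z) r - S (apply_bcontfun w) r
      = integral {0..r} (\<lambda>s. g (exp (c * s) *\<^sub>R apply_bcontfun z s, u s) - g (exp (c * s) *\<^sub>R apply_bcontfun w s, u s))"
      using iz iw by (simp add: S_def Henstock_Kurzweil_Integration.integral_diff)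
    also have "norm \<dots> \<le> integral {0..r} (\<lambda>s. L * D * exp (c * s))"
    proof (rule Henstock_Kurzweil_Integration.integral_norm_bound_integral)
      fix s assume s: "s \<in> {0..r}"
      have "norm (g (exp (c * s) *\<^sub>R apply_bcontfun z s, u s) - g (exp (c * s) *\<^sub>R apply_bcontfun w s, u s))
         \<le> L * norm (exp (c * s) *\<^sub>R apply_bcontfun z s - exp (c * s) *\<^sub>R apply_bcontfun w s)" by (rule g_lipschitz)
      also have "\<dots> = L * (exp (c * s) * norm (apply_bcontfun z s - apply_bcontfun w s))"
        by (simp flip: scaleR_diff_right)
      also have "\<dots> \<le> L * (exp (c * s) * D)"
        using D[of s] L_nonneg by (intro mult_left_mono) auto
      finally show "norm (g (exp (c * s) *\<^sub>R apply_bcontfun z s, u s) - g (exp (c * s) *\<^sub>R apply_bcontfun w s, u s))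
         \<le> L * D * exp (c * s)" by (simp add: mult_ac)
    qed (use iz iw E in \<open>auto intro: Henstock_Kurzweil_Integration.integrable_diff\<close>)
    also have "\<dots> = L * D * ((exp (c * r) - 1) / c)" using E by (rule integral_unique)
    also have "\<dots> \<le> L * D * (exp (c * r) / c)"
      using L_nonneg D0 c by (intro mult_left_mono divide_right_mono) auto
    finally have "norm (S (apply_bcontfun z) r - S (apply_bcontfun w) r) \<le> L * D * (exp (c * r) / c)" .
    then have "exp (- c * r) * norm (S (apply_bcontfun z) r - S (apply_bcontfun w) r) \<le> L / c * D"
      by (simp add: exp_minus field_simps)
    then show "dist (apply_bcontfun (Bcontfun (\<Phi> (apply_bcontfun z))) t)
        (apply_bcontfun (Bcontfun (\<Phi> (apply_bcontfun w))) t) \<le> L / c * dist z w"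
      unfolding app D_def by (simp add: \<Phi>_def dist_norm flip: r_def scaleR_diff_right)
  qed
  then obtain z where z: "Bcontfun (\<Phi> (apply_bcontfun z)) = z"
    using banach_fix_type[OF c(2,3), of "\<lambda>z. Bcontfun (\<Phi> (apply_bcontfun z))"] by blast
  define y where "y = (\<lambda>t. exp (c * t) *\<^sub>R apply_bcontfun z t)"
  have "y t = y\<^sub>0 + integral {0..t} (\<lambda>s. g (y s, u s))" if "t \<ge> 0" for t
  proof -
    have "apply_bcontfun z t = \<Phi> (apply_bcontfun z) t" using app[of z] z by simp
    then have "y t = S (apply_bcontfun z) t"
      using that by (simp add: y_def \<Phi>_def flip: exp_add)
    also have "\<dots> = y\<^sub>0 + integral {0..t} (\<lambda>s. g (y s, u s))" by (simp add: S_def y_def)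
    finally show ?thesis .
  qed
  moreover have "(\<lambda>s. g (y s, u s)) integrable_on {0..t}" if "t \<ge> 0" for t
    using int[of "apply_bcontfun z"] that by (simp add: y_def)
  ultimately have "integral_solution u y\<^sub>0 y"
    by (simp add: integral_solution_def has_integral_iff)
  then show ?thesis by blast
qed

lemma trajectory_eq:
  assumes "u \<in> controls" "integral_solution u y\<^sub>0 y" "t \<ge> 0"
  shows "trajectory g t u y\<^sub>0 = y t"
  unfolding trajectory_def is_solution_iff_integral_solution
  using assms integral_solution_unique by (intro the_equality) auto

lemma trajectory_integral_solution:
  assumes u: "u \<in> controls"
  shows "integral_solution u y\<^sub>0 (\<lambda>s. trajectory g s u y\<^sub>0)"
proof -
  obtain y where y: "integral_solution u y\<^sub>0 y" using integral_solution_exists[OF u] by blast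
  have "((\<lambda>s. g (trajectory g s u y\<^sub>0, u s)) has_integral (trajectory g t u y\<^sub>0 - y\<^sub>0)) {0..t}
    \<longleftrightarrow> ((\<lambda>s. g (y s, u s)) has_integral (y t - y\<^sub>0)) {0..t}" if "t \<ge> 0" for t
    unfolding trajectory_eq[OF u y that]
    by (rule has_integral_cong) (simp add: trajectory_eq[OF u y])
  then show ?thesis using y by (simp add: integral_solution_def)
qed

lemma trajectory_0: "u \<in> controls \<Longrightarrow> trajectory g 0 u y\<^sub>0 = y\<^sub>0"
  using integral_solution_eq[OF trajectory_integral_solution, of u 0] by simp

lemma trajectory_shift:
  assumes u: "u \<in> controls" and "\<tau> \<ge> 0" "t \<ge> 0"
  shows "trajectory g t (\<lambda>s. u (s + \<tau>)) (trajectory g \<tau> u y\<^sub>0) = trajectory g (t + \<tau>) u y\<^sub>0"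
proof (rule trajectory_eq[OF shift_in_controls[OF u]])
  let ?y = "\<lambda>s. trajectory g s u y\<^sub>0"
  show "integral_solution (\<lambda>s. u (s + \<tau>)) (?y \<tau>) (\<lambda>t. ?y (t + \<tau>))"
    unfolding integral_solution_def
  proof (intro allI impI)
    fix t :: real assume "t \<ge> 0"
    then have "((\<lambda>r. g (?y r, u r)) has_integral (?y (t + \<tau>) - ?y \<tau>)) {\<tau>..t + \<tau>}"
      using assms by (intro integral_solution_increment[OF trajectory_integral_solution[OF u, of y\<^sub>0]]) auto
    from has_integral_shift_real_ivl[OF this, of \<tau>]
    show "((\<lambda>s. g (?y (s + \<tau>), u (s + \<tau>))) has_integral (?y (t + \<tau>) - ?y \<tau>)) {0..t}" by simp
  qed
qed (use assms in auto)

text \<open>The concatenation of the two trajectories solves the integral equation for the switched control;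
at the time \<open>\<tau>\<close> itself the integrands may disagree, which the integral does not see.\<close>

lemma trajectory_switch:
  assumes u: "u \<in> controls" and v: "v \<in> controls" and \<tau>: "\<tau> \<ge> 0" and t: "t \<ge> 0"
  shows "trajectory g t (switch_control \<tau> u v) y\<^sub>0 =
    (if t \<le> \<tau> then trajectory g t u y\<^sub>0 else trajectory g (t - \<tau>) v (trajectory g \<tau> u y\<^sub>0))"
proof (rule trajectory_eq[OF switch_in_controls[OF u v \<tau>] _ t])
  let ?w = "switch_control \<tau> u v"
  define y where "y = (\<lambda>s. trajectory g s u y\<^sub>0)"
  define z where "z = (\<lambda>s. trajectory g s v (y \<tau>))"
  define x where "x = (\<lambda>t. if t \<le> \<tau> then y t else z (t - \<tau>))"
  have y: "integral_solution u y\<^sub>0 y" and z: "integral_solution v (y \<tau>) z"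
    unfolding y_def z_def by (auto intro: trajectory_integral_solution u v)
  have *: "((\<lambda>s. g (x s, ?w s)) has_integral (y t - y\<^sub>0)) {0..t}" if "0 \<le> t" "t \<le> \<tau>" for t
  proof (rule has_integral_spike_finite[of "{\<tau>}"])
    show "((\<lambda>s. g (y s, u s)) has_integral (y t - y\<^sub>0)) {0..t}"
      using y that by (simp add: integral_solution_def)
  qed (use that in \<open>auto simp: x_def switch_control_def\<close>)
  have "((\<lambda>s. g (x s, ?w s)) has_integral (x t - y\<^sub>0)) {0..t}" if t: "t \<ge> 0" for t
  proof (cases "t \<le> \<tau>")
    case True with *[OF t] show ?thesis by (simp add: x_def)
  next
    case False
    have "((\<lambda>s. g (z s, v s)) has_integral (z (t - \<tau>) - y \<tau>)) {0..t - \<tau>}"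
      using z False by (simp add: integral_solution_def)
    from has_integral_shift_real_ivl[OF this, of "- \<tau>"]
    have "((\<lambda>s. g (z (s - \<tau>), v (s - \<tau>))) has_integral (z (t - \<tau>) - y \<tau>)) {\<tau>..t}" by simp
    then have "((\<lambda>s. g (x s, ?w s)) has_integral (z (t - \<tau>) - y \<tau>)) {\<tau>..t}"
      by (rule has_integral_spike_finite[of "{\<tau>}", rotated 2]) (auto simp: x_def switch_control_def)
    from has_integral_combine[OF \<tau> _ *[OF \<tau> order_refl] this] False
    show ?thesis by (simp add: x_def)
  qed
  then have "integral_solution ?w y\<^sub>0 x" by (simp add: integral_solution_def)
  then show "integral_solution ?w y\<^sub>0 (\<lambda>t. if t \<le> \<tau> then trajectory g t u y\<^sub>0
      else trajectory g (t - \<tau>) v (trajectory g \<tau> u y\<^sub>0))"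
    unfolding x_def y_def z_def .
qed

end

section \<open>Tracking\<close>

text \<open>Whatever velocity is chosen at \<open>y\<^sub>1\<close>, up to an arbitrarily small error some velocity at \<open>y\<^sub>2\<close> does
not increase the distance.\<close>

locale nonexpansive_control_system = control_system g L a
  for g :: "(real^'d) \<times> 'u::metric_space \<Rightarrow> real^'d" and L a :: real +
  fixes N :: "(real^'d) set" and h :: "real^'d \<Rightarrow> real"
  assumes compact_N: "compact N"
    and invariant: "forward_invariant g N"
    and continuous_h: "continuous_on UNIV h"
    and nonexpansive: "\<lbrakk>y\<^sub>1 \<in> N; y\<^sub>2 \<in> N\<rbrakk> \<Longrightarrow>
      (SUP u. INF v. (y\<^sub>1 - y\<^sub>2) \<bullet> (g (y\<^sub>1, u) - g (y\<^sub>2, v))) \<le> 0"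
begin

lemma trajectory_in_N: "\<lbrakk>y \<in> N; u \<in> controls; t \<ge> 0\<rbrakk> \<Longrightarrow> trajectory g t u y \<in> N"
  using invariant by (simp add: forward_invariant_def)

text \<open>The scalar product splits into a term in \<open>u\<close> and a term in \<open>v\<close>, so the hypothesis says that the
supremum of the first is at most the supremum of the second. One \<open>v\<close> that is near-optimal for the
second supremum therefore serves for every \<open>u\<close>.\<close>

lemma near_optimal_velocity:
  assumes y: "y\<^sub>1 \<in> N" "y\<^sub>2 \<in> N" and "\<eta> > 0"
  obtains v where "\<And>u. (y\<^sub>1 - y\<^sub>2) \<bullet> (g (y\<^sub>1, u) - g (y\<^sub>2, v)) \<le> \<eta>"
proof -
  define p where "p = y\<^sub>1 - y\<^sub>2"
  define \<phi> where "\<phi> = (\<lambda>u v. p \<bullet> (g (y\<^sub>1, u) - g (y\<^sub>2, v)))"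
  define c where "c = (SUP v. p \<bullet> g (y\<^sub>2, v))"
  have bd: "\<bar>p \<bullet> g (y, u)\<bar> \<le> norm p * (a * (1 + norm y))" for y u
    by (rule order_trans[OF Cauchy_Schwarz_ineq2]) (intro mult_left_mono g_growth norm_ge_zero)
  have bdd: "bdd_above (range (\<lambda>v. p \<bullet> g (y\<^sub>2, v)))"
    using bd[of y\<^sub>2] by (intro bdd_aboveI2) (rule abs_le_D1)
  have \<phi>_bd: "\<bar>\<phi> u v\<bar> \<le> norm p * (a * (1 + norm y\<^sub>1)) + norm p * (a * (1 + norm y\<^sub>2))" for u v
    using bd[of y\<^sub>1 u] bd[of y\<^sub>2 v] by (simp add: \<phi>_def inner_diff_right)
  then have \<phi>_below: "bdd_below (range (\<phi> u))" for u
    by (intro bdd_belowI2[where m = "- (norm p * (a * (1 + norm y\<^sub>1)) + norm p * (a * (1 + norm y\<^sub>2)))"])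
       (metis abs_le_iff minus_le_iff)
  have INF_above: "bdd_above (range (\<lambda>u. INF v. \<phi> u v))"
  proof (rule bdd_aboveI2)
    fix u
    show "(INF v. \<phi> u v) \<le> norm p * (a * (1 + norm y\<^sub>1)) + norm p * (a * (1 + norm y\<^sub>2))"
      using cINF_lower[OF \<phi>_below UNIV_I, of u undefined] \<phi>_bd[of u undefined] by linarith
  qed
  have le_c: "p \<bullet> g (y\<^sub>1, u) \<le> c" for u
  proof -
    have "p \<bullet> g (y\<^sub>1, u) - c \<le> (INF v. \<phi> u v)"
    proof (rule cINF_greatest)
      fix v
      have "p \<bullet> g (y\<^sub>2, v) \<le> c" unfolding c_def by (rule cSUP_upper[OF UNIV_I bdd])
      then show "p \<bullet> g (y\<^sub>1, u) - c \<le> \<phi> u v" by (simp add: \<phi>_def inner_diff_right)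
    qed simp
    also have "\<dots> \<le> (SUP u. INF v. \<phi> u v)" by (rule cSUP_upper[OF UNIV_I INF_above])
    also have "\<dots> \<le> 0" using nonexpansive[OF y] by (simp add: \<phi>_def p_def)
    finally show ?thesis by simp
  qed
  have "c - \<eta> < c" using \<open>\<eta> > 0\<close> by simp
  then obtain v where "c - \<eta> < p \<bullet> g (y\<^sub>2, v)"
    unfolding c_def using less_cSUP_iff[OF UNIV_not_empty bdd] by blast
  then have "p \<bullet> (g (y\<^sub>1, u) - g (y\<^sub>2, v)) \<le> \<eta>" for u
    using le_c[of u] by (simp add: inner_diff_right)
  then show thesis unfolding p_def by (rule that)
qed

text \<open>Expand the squared distance around the initial difference \<open>p\<close>. The first order term is the
integral of \<open>p \<bullet> (g (Y s, u s) - g (Z s, v))\<close>: with the states frozen at time 0 it is controlled by the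
choice of \<open>v\<close>, and freezing costs \<open>O(t)\<close> because \<open>g\<close> is Lipschitz and both trajectories are.
The second order term is \<open>O(t\<^sup>2)\<close>.\<close>

lemma one_step_tracking:
  obtains \<kappa> where "\<kappa> \<ge> 0"
    "\<And>y\<^sub>1 y\<^sub>2 u \<eta>. \<lbrakk>y\<^sub>1 \<in> N; y\<^sub>2 \<in> N; u \<in> controls; \<eta> > 0\<rbrakk> \<Longrightarrow> \<exists>v. \<forall>t\<ge>0.
       (norm (trajectory g t u y\<^sub>1 - trajectory g t (\<lambda>_. v) y\<^sub>2))\<^sup>2
         \<le> (norm (y\<^sub>1 - y\<^sub>2))\<^sup>2 + t * (\<eta> + \<kappa> * t)"
proof -
  obtain R\<^sub>0 where R0: "\<And>y. y \<in> N \<Longrightarrow> norm y \<le> R\<^sub>0"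
    using compact_imp_bounded[OF compact_N] unfolding bounded_iff by blast
  define R where "R = max R\<^sub>0 0"
  have R: "\<And>y. y \<in> N \<Longrightarrow> norm y \<le> R" "R \<ge> 0" using R0 by (force simp: R_def)+
  define C where "C = a * (1 + R)"
  have C: "C \<ge> 0" using a_pos R by (simp add: C_def)
  \<comment> \<open>\<open>R\<close> bounds the states and \<open>C\<close> the velocities. The first summand of \<open>\<kappa>\<close> comes from freezing the states (twice, with \<open>norm p \<le> 2 * R\<close>), the second one from the quadratic term.\<close>
  define \<kappa> where "\<kappa> = 8 * R * L * C + 4 * C\<^sup>2"
  have "\<kappa> \<ge> 0" using R C L_nonneg by (simp add: \<kappa>_def)
  moreover have "\<exists>v. \<forall>t\<ge>0. (norm (trajectory g t u y\<^sub>1 - trajectory g t (\<lambda>_. v) y\<^sub>2))\<^sup>2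
         \<le> (norm (y\<^sub>1 - y\<^sub>2))\<^sup>2 + t * (\<eta> + \<kappa> * t)"
    if y: "y\<^sub>1 \<in> N" "y\<^sub>2 \<in> N" and u: "u \<in> controls" and \<eta>: "\<eta> > 0" for y\<^sub>1 y\<^sub>2 u \<eta>
  proof -
    define p where "p = y\<^sub>1 - y\<^sub>2"
    obtain v where v: "\<And>w. p \<bullet> (g (y\<^sub>1, w) - g (y\<^sub>2, v)) \<le> \<eta> / 2"
      using near_optimal_velocity[OF y, of "\<eta> / 2"] \<eta> unfolding p_def by auto
    define Y where "Y = (\<lambda>t. trajectory g t u y\<^sub>1)"
    define Z where "Z = (\<lambda>t. trajectory g t (\<lambda>_. v) y\<^sub>2)"
    have solY: "integral_solution u y\<^sub>1 Y" and solZ: "integral_solution (\<lambda>_. v) y\<^sub>2 Z"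
      unfolding Y_def Z_def by (auto intro: trajectory_integral_solution u const_in_controls)
    have Y0: "Y 0 = y\<^sub>1" and Z0: "Z 0 = y\<^sub>2"
      unfolding Y_def Z_def by (auto intro: trajectory_0 u const_in_controls)
    have YN: "norm (Y t) \<le> R" and ZN: "norm (Z t) \<le> R" if "t \<ge> 0" for t
      unfolding Y_def Z_def using that y
      by (auto intro!: R(1) trajectory_in_N u const_in_controls)
    have dY: "norm (Y t - y\<^sub>1) \<le> C * t" if "t \<ge> 0" for t
      using integral_solution_lipschitz[OF solY, of t R 0 t] YN that Y0 by (simp add: C_def)
    have dZ: "norm (Z t - y\<^sub>2) \<le> C * t" if "t \<ge> 0" for t
      using integral_solution_lipschitz[OF solZ, of t R 0 t] ZN that Z0 by (simp add: C_def)
    have p: "norm p \<le> 2 * R"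
      using norm_triangle_ineq4[of y\<^sub>1 y\<^sub>2] R(1)[OF y(1)] R(1)[OF y(2)] by (simp add: p_def)
    have "(norm (Y t - Z t))\<^sup>2 \<le> (norm p)\<^sup>2 + t * (\<eta> + \<kappa> * t)" if t: "t \<ge> 0" for t
    proof -
      define q where "q = (Y t - Z t) - p"
      have "((\<lambda>s. g (Y s, u s) - g (Z s, v)) has_integral (Y t - y\<^sub>1) - (Z t - y\<^sub>2)) {0..t}"
        using solY solZ t by (intro has_integral_diff) (auto simp: integral_solution_def)
      from has_integral_linear[OF this bounded_linear_inner_right[of p]]
      have "((\<lambda>s. p \<bullet> (g (Y s, u s) - g (Z s, v))) has_integral p \<bullet> ((Y t - y\<^sub>1) - (Z t - y\<^sub>2))) {0..t}"
        by (simp only: o_def)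
      moreover have "(Y t - y\<^sub>1) - (Z t - y\<^sub>2) = q" by (simp add: q_def p_def)
      ultimately have "((\<lambda>s. p \<bullet> (g (Y s, u s) - g (Z s, v))) has_integral p \<bullet> q) {0..t}"
        by (simp only:)
      moreover have "((\<lambda>s. \<eta> / 2 + 4 * R * L * C * t) has_integral t * (\<eta> / 2 + 4 * R * L * C * t)) {0..t}"
        using has_integral_const_real[of "\<eta> / 2 + 4 * R * L * C * t" 0 t] t by simp
      moreover have "p \<bullet> (g (Y s, u s) - g (Z s, v)) \<le> \<eta> / 2 + 4 * R * L * C * t"
        if s: "s \<in> {0..t}" for s
      proof -
        have err: "\<bar>p \<bullet> (g (x, w) - g (x', w))\<bar> \<le> 2 * R * L * C * t"
          if "norm (x - x') \<le> C * s" for x x' w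
        proof -
          have "\<bar>p \<bullet> (g (x, w) - g (x', w))\<bar> \<le> norm p * norm (g (x, w) - g (x', w))"
            by (rule Cauchy_Schwarz_ineq2)
          also have "\<dots> \<le> (2 * R) * (L * norm (x - x'))"
            using p R by (intro mult_mono g_lipschitz) auto
          also have "\<dots> \<le> (2 * R) * (L * (C * t))"
            using R L_nonneg C s order_trans[OF that mult_left_mono[of s t C]]
            by (intro mult_left_mono) auto
          finally show ?thesis by (simp add: mult_ac)
        qed
        have "p \<bullet> (g (Y s, u s) - g (Z s, v)) = p \<bullet> (g (y\<^sub>1, u s) - g (y\<^sub>2, v))
          + p \<bullet> (g (Y s, u s) - g (y\<^sub>1, u s)) - p \<bullet> (g (Z s, v) - g (y\<^sub>2, v))"
          by (simp add: inner_diff_right)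
        then show ?thesis
          using v[of "u s"] err[OF dY, of "u s"] err[OF dZ, of v] s by (auto simp: abs_le_iff)
      qed
      ultimately have drift: "p \<bullet> q \<le> t * (\<eta> / 2 + 4 * R * L * C * t)"
        by (rule has_integral_le)
      have "norm q \<le> 2 * C * t"
        using norm_triangle_ineq4[of "Y t - y\<^sub>1" "Z t - y\<^sub>2"] dY[OF t] dZ[OF t]
        by (simp add: q_def p_def algebra_simps)
      then have "(norm q)\<^sup>2 \<le> (2 * C * t)\<^sup>2" by (rule power_mono) simp
      moreover have "(norm (Y t - Z t))\<^sup>2 = (norm p)\<^sup>2 + 2 * (p \<bullet> q) + (norm q)\<^sup>2"
        unfolding q_def by (simp add: power2_norm_eq_inner inner_diff_left inner_diff_right inner_commute)
      ultimately show ?thesis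
        using drift by (simp add: \<kappa>_def power2_eq_square algebra_simps)
    qed
    then show ?thesis by (auto simp: Y_def Z_def p_def)
  qed
  ultimately show thesis by (rule that)
qed

text \<open>Restart the one-step construction after every time step \<open>\<delta>\<close>. The error committed in one step is of
order \<open>\<delta> * (\<eta> + \<kappa> * \<delta>)\<close>, so the total error over \<open>{0..T}\<close> is at most \<open>T * (\<eta> + \<kappa> * \<delta>)\<close>,
which can be made as small as desired.\<close>

lemma tracking_control:
  assumes y: "y\<^sub>1 \<in> N" "y\<^sub>2 \<in> N" and u: "u \<in> controls" and \<epsilon>: "\<epsilon> > 0" and T: "T \<ge> 0"
  obtains v where "v \<in> controls"
    "\<And>t. t \<in> {0..T} \<Longrightarrow>
       (norm (trajectory g t u y\<^sub>1 - trajectory g t v y\<^sub>2))\<^sup>2 \<le> (norm (y\<^sub>1 - y\<^sub>2))\<^sup>2 + \<epsilon>"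
proof -
  obtain \<kappa> where \<kappa>: "\<kappa> \<ge> 0"
    and step: "\<And>y\<^sub>1 y\<^sub>2 u \<eta>. \<lbrakk>y\<^sub>1 \<in> N; y\<^sub>2 \<in> N; u \<in> controls; \<eta> > 0\<rbrakk> \<Longrightarrow> \<exists>v. \<forall>t\<ge>0.
       (norm (trajectory g t u y\<^sub>1 - trajectory g t (\<lambda>_. v) y\<^sub>2))\<^sup>2
         \<le> (norm (y\<^sub>1 - y\<^sub>2))\<^sup>2 + t * (\<eta> + \<kappa> * t)"
    using one_step_tracking by blast
  define \<eta> where "\<eta> = \<epsilon> / (2 * (T + 1))"
  define \<delta> where "\<delta> = \<eta> / (\<kappa> + 1)"
  have \<eta>: "\<eta> > 0" and \<delta>: "\<delta> > 0" using \<epsilon> T \<kappa> by (auto simp: \<eta>_def \<delta>_def)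
  have \<kappa>\<delta>: "\<kappa> * \<delta> \<le> \<eta>" using \<kappa> \<eta> by (simp add: \<delta>_def field_simps)
  define r where "r = 2 * \<eta>"
  have "\<exists>v\<in>controls. \<forall>t\<in>{0..real n * \<delta>}.
      (norm (trajectory g t u y\<^sub>1 - trajectory g t v y\<^sub>2))\<^sup>2 \<le> (norm (y\<^sub>1 - y\<^sub>2))\<^sup>2 + t * r"
    if "y\<^sub>1 \<in> N" "y\<^sub>2 \<in> N" "u \<in> controls" for n y\<^sub>1 y\<^sub>2 u
    using that
  proof (induction n arbitrary: y\<^sub>1 y\<^sub>2 u)
    case 0
    then show ?case
      by (intro bexI[OF _ const_in_controls[of undefined]])
         (auto simp: trajectory_0 const_in_controls)
  next
    case (Suc n)
    obtain c where c: "\<And>t. t \<ge> 0 \<Longrightarrow>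
       (norm (trajectory g t u y\<^sub>1 - trajectory g t (\<lambda>_. c) y\<^sub>2))\<^sup>2
         \<le> (norm (y\<^sub>1 - y\<^sub>2))\<^sup>2 + t * (\<eta> + \<kappa> * t)"
      using step[OF Suc.prems \<eta>] by blast
    have first: "(norm (trajectory g t u y\<^sub>1 - trajectory g t (\<lambda>_. c) y\<^sub>2))\<^sup>2
         \<le> (norm (y\<^sub>1 - y\<^sub>2))\<^sup>2 + t * r" if "0 \<le> t" "t \<le> \<delta>" for t
    proof -
      have "\<kappa> * t \<le> \<kappa> * \<delta>" using \<kappa> that by (intro mult_left_mono) auto
      then have "t * (\<eta> + \<kappa> * t) \<le> t * r"
        using \<kappa>\<delta> that by (intro mult_left_mono) (auto simp: r_def)
      then show ?thesis using c[OF that(1)] by linarith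
    qed
    define z\<^sub>1 where "z\<^sub>1 = trajectory g \<delta> u y\<^sub>1"
    define z\<^sub>2 where "z\<^sub>2 = trajectory g \<delta> (\<lambda>_. c) y\<^sub>2"
    define u' where "u' = (\<lambda>s. u (s + \<delta>))"
    have "z\<^sub>1 \<in> N" "z\<^sub>2 \<in> N" "u' \<in> controls"
      unfolding z\<^sub>1_def z\<^sub>2_def u'_def using Suc.prems \<delta>
      by (auto intro!: trajectory_in_N const_in_controls shift_in_controls)
    from Suc.IH[OF this] obtain v where v: "v \<in> controls"
      and next_steps: "\<And>t. t \<in> {0..real n * \<delta>} \<Longrightarrow>
        (norm (trajectory g t u' z\<^sub>1 - trajectory g t v z\<^sub>2))\<^sup>2 \<le> (norm (z\<^sub>1 - z\<^sub>2))\<^sup>2 + t * r"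
      by blast
    define w where "w = switch_control \<delta> (\<lambda>_. c) v"
    have w: "w \<in> controls" unfolding w_def using v \<delta> by (intro switch_in_controls const_in_controls) auto
    have "(norm (trajectory g t u y\<^sub>1 - trajectory g t w y\<^sub>2))\<^sup>2 \<le> (norm (y\<^sub>1 - y\<^sub>2))\<^sup>2 + t * r"
      if t: "t \<in> {0..real (Suc n) * \<delta>}" for t
    proof (cases "t \<le> \<delta>")
      case True
      then show ?thesis using first[of t] t \<delta> v
        by (simp add: w_def trajectory_switch const_in_controls)
    next
      case False
      have "trajectory g t u y\<^sub>1 = trajectory g (t - \<delta>) u' z\<^sub>1"
        using trajectory_shift[OF Suc.prems(3), of \<delta> "t - \<delta>" y\<^sub>1] False \<delta> by (simp add: u'_def z\<^sub>1_def)
      moreover have "trajectory g t w y\<^sub>2 = trajectory g (t - \<delta>) v z\<^sub>2"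
        using False \<delta> v by (simp add: w_def z\<^sub>2_def trajectory_switch const_in_controls)
      moreover have "t - \<delta> \<in> {0..real n * \<delta>}" using t False by (auto simp: algebra_simps)
      ultimately have "(norm (trajectory g t u y\<^sub>1 - trajectory g t w y\<^sub>2))\<^sup>2
          \<le> (norm (z\<^sub>1 - z\<^sub>2))\<^sup>2 + (t - \<delta>) * r" using next_steps by simp
      also have "(norm (z\<^sub>1 - z\<^sub>2))\<^sup>2 \<le> (norm (y\<^sub>1 - y\<^sub>2))\<^sup>2 + \<delta> * r"
        unfolding z\<^sub>1_def z\<^sub>2_def using first[of \<delta>] \<delta> by simp
      finally show ?thesis by (simp add: algebra_simps)
    qed
    then show ?case using w by blast
  qed
  note iterate = this
  obtain n :: nat where n: "T / \<delta> \<le> real n" using real_arch_simple by blast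
  then have "T \<le> real n * \<delta>" using \<delta> by (simp add: field_simps)
  moreover from iterate[OF y u, of n] obtain v where v: "v \<in> controls"
    and tr: "\<And>t. t \<in> {0..real n * \<delta>} \<Longrightarrow>
      (norm (trajectory g t u y\<^sub>1 - trajectory g t v y\<^sub>2))\<^sup>2 \<le> (norm (y\<^sub>1 - y\<^sub>2))\<^sup>2 + t * r"
    by blast
  moreover have "t * r \<le> \<epsilon>" if "t \<in> {0..T}" for t
  proof -
    have "t * r \<le> (T + 1) * r" using that \<eta> by (intro mult_right_mono) (auto simp: r_def)
    also have "(T + 1) * r = \<epsilon>" using T by (simp add: r_def \<eta>_def field_simps)
    finally show ?thesis .
  qed
  ultimately have "(norm (trajectory g t u y\<^sub>1 - trajectory g t v y\<^sub>2))\<^sup>2 \<le> (norm (y\<^sub>1 - y\<^sub>2))\<^sup>2 + \<epsilon>"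
    if "t \<in> {0..T}" for t
    using that tr[of t] by (meson add_left_mono atLeastAtMost_iff order_trans)
  with v show thesis by (rule that)
qed

section \<open>Value functions\<close>

definition cost :: "real \<Rightarrow> (real \<Rightarrow> 'u) \<Rightarrow> real^'d \<Rightarrow> real" where
  "cost t u y = integral {0..t} (\<lambda>s. h (trajectory g s u y))"

abbreviation V :: "real \<Rightarrow> real^'d \<Rightarrow> real" where "V \<equiv> value_function g h"

definition M :: real where "M = (SUP y\<in>N. \<bar>h y\<bar>)"

lemma h_bound: "y \<in> N \<Longrightarrow> \<bar>h y\<bar> \<le> M"
  unfolding M_def
proof (rule cSUP_upper)
  have "continuous_on N (\<lambda>y. \<bar>h y\<bar>)"
    using continuous_h by (intro continuous_intros) (auto intro: continuous_on_subset)
  then show "bdd_above ((\<lambda>y. \<bar>h y\<bar>) ` N)"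
    using compact_N by (intro bounded_imp_bdd_above compact_imp_bounded compact_continuous_image)
qed

lemma running_cost_integrable:
  assumes u: "u \<in> controls" and "0 \<le> s"
  shows "(\<lambda>r. h (trajectory g r u y)) integrable_on {s..t}"
proof (rule integrable_continuous_real)
  have "continuous_on {0..} (\<lambda>r. trajectory g r u y)"
    by (rule integral_solution_continuous[OF trajectory_integral_solution[OF u]])
  then have "continuous_on {s..t} (\<lambda>r. trajectory g r u y)"
    by (rule continuous_on_subset) (use \<open>0 \<le> s\<close> in auto)
  then show "continuous_on {s..t} (\<lambda>r. h (trajectory g r u y))"
    by (rule continuous_on_compose2[OF continuous_h]) simp
qed

lemma cost_bound:
  assumes "y \<in> N" "u \<in> controls" "t \<ge> 0"
  shows "\<bar>cost t u y\<bar> \<le> M * t"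
proof -
  have "norm (cost t u y) \<le> integral {0..t} (\<lambda>_. M)"
    unfolding cost_def
    using assms by (intro Henstock_Kurzweil_Integration.integral_norm_bound_integral running_cost_integrable)
      (auto intro!: h_bound trajectory_in_N)
  then show ?thesis using assms by (simp add: mult.commute)
qed

lemma cost_split:
  assumes u: "u \<in> controls" and "0 \<le> \<tau>" "0 \<le> t"
  shows "cost (t + \<tau>) u y = cost \<tau> u y + cost t (\<lambda>s. u (s + \<tau>)) (trajectory g \<tau> u y)"
proof -
  let ?f = "\<lambda>s. h (trajectory g s u y)"
  have "cost (t + \<tau>) u y = cost \<tau> u y + integral {\<tau>..t + \<tau>} ?f"
    unfolding cost_def using assms
    by (intro Henstock_Kurzweil_Integration.integral_combine[symmetric] running_cost_integrable) auto
  moreover have "(?f has_integral integral {\<tau>..t + \<tau>} ?f) {\<tau>..t + \<tau>}"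
    using assms by (intro integrable_integral running_cost_integrable)
  from has_integral_shift_real_ivl[OF this, of \<tau>]
  have "((\<lambda>s. ?f (s + \<tau>)) has_integral integral {\<tau>..t + \<tau>} ?f) {0..t}" by simp
  then have "((\<lambda>s. h (trajectory g s (\<lambda>s. u (s + \<tau>)) (trajectory g \<tau> u y)))
      has_integral integral {\<tau>..t + \<tau>} ?f) {0..t}"
    by (rule has_integral_eq[rotated]) (use assms in \<open>auto simp: trajectory_shift\<close>)
  then have "cost t (\<lambda>s. u (s + \<tau>)) (trajectory g \<tau> u y) = integral {\<tau>..t + \<tau>} ?f"
    unfolding cost_def by (rule integral_unique)
  ultimately show ?thesis by simp
qed

text \<open>The cost bound keeps the infimum in the definition of the value function from being taken over a
set that is unbounded below.\<close>

lemma value_function_le: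
  assumes "y \<in> N" "u \<in> controls" "t > 0"
  shows "t * V t y \<le> cost t u y"
proof -
  have "- M \<le> 1 / t * cost t u y" if "u \<in> controls" for u
    using cost_bound[OF assms(1) that, of t] assms(3) by (simp add: field_simps abs_le_iff)
  then have "bdd_below ((\<lambda>u. 1 / t * cost t u y) ` controls)"
    by (intro bdd_belowI2)
  then have "V t y \<le> 1 / t * cost t u y"
    unfolding value_function_def cost_def using assms(2) by (rule cINF_lower)
  then show ?thesis using assms(3) by (simp add: field_simps)
qed

lemma value_function_ge:
  assumes "t > 0" "\<And>u. u \<in> controls \<Longrightarrow> t * c \<le> cost t u y"
  shows "c \<le> V t y"
  unfolding value_function_def
proof (rule cINF_greatest)
  show "controls \<noteq> {}" using const_in_controls by blast
  show "c \<le> 1 / t * integral {0..t} (\<lambda>s. h (trajectory g s u y))" if "u \<in> controls" for u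
    using assms(2)[OF that] assms(1) by (simp add: cost_def field_simps)
qed

lemma value_function_bound:
  assumes "y \<in> N" "t > 0"
  shows "\<bar>V t y\<bar> \<le> M"
proof -
  have "t * V t y \<le> t * M"
    using value_function_le[OF assms(1) const_in_controls assms(2)]
      cost_bound[OF assms(1) const_in_controls, of t] assms(2) 
    by (metis abs_le_D1 less_eq_real_def mult.commute order_trans)
  then have "V t y \<le> M" using assms(2) by simp
  moreover have "- M \<le> V t y"
  proof (rule value_function_ge[OF assms(2)])
    fix u :: "real \<Rightarrow> 'u" assume "u \<in> controls"
    from cost_bound[OF assms(1) this, of t] assms(2) show "t * - M \<le> cost t u y"
      by (simp add: abs_le_iff mult.commute)
  qed
  ultimately show ?thesis by simp
qed

text \<open>A near-optimal control for \<open>y\<^sub>1\<close> is replaced by a tracking control from \<open>y\<^sub>2\<close>; the states then stay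
within the modulus of uniform continuity of \<open>h\<close>, at all times and for every horizon.\<close>

lemma value_functions_equicontinuous:
  assumes "e > 0"
  obtains d where "d > 0"
    "\<And>t y\<^sub>1 y\<^sub>2. \<lbrakk>t > 0; y\<^sub>1 \<in> N; y\<^sub>2 \<in> N; norm (y\<^sub>1 - y\<^sub>2) < d\<rbrakk> \<Longrightarrow> \<bar>V t y\<^sub>1 - V t y\<^sub>2\<bar> \<le> e"
proof -
  have "uniformly_continuous_on N h"
    using compact_N continuous_h
    by (intro compact_uniformly_continuous) (auto intro: continuous_on_subset)
  then obtain d where d: "d > 0"
    and h: "\<And>x x'. \<lbrakk>x \<in> N; x' \<in> N; norm (x' - x) < d\<rbrakk> \<Longrightarrow> \<bar>h x' - h x\<bar> < e"
    using \<open>e > 0\<close> unfolding uniformly_continuous_on_def by (auto simp: dist_norm)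
  have le: "V t y\<^sub>2 \<le> V t y\<^sub>1 + e"
    if t: "t > 0" and y: "y\<^sub>1 \<in> N" "y\<^sub>2 \<in> N" and close: "norm (y\<^sub>1 - y\<^sub>2) < d" for t y\<^sub>1 y\<^sub>2
  proof -
    \<comment> \<open>A tracking error for which the distance stays below \<open>d\<close>.\<close>
    define \<epsilon> where "\<epsilon> = (d\<^sup>2 - (norm (y\<^sub>1 - y\<^sub>2))\<^sup>2) / 2"
    have "(norm (y\<^sub>1 - y\<^sub>2))\<^sup>2 < d\<^sup>2" using close by (intro power_strict_mono) auto
    then have \<epsilon>: "\<epsilon> > 0" "(norm (y\<^sub>1 - y\<^sub>2))\<^sup>2 + \<epsilon> < d\<^sup>2" by (auto simp: \<epsilon>_def field_simps)
    have "V t y\<^sub>2 - e \<le> V t y\<^sub>1"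
    proof (rule value_function_ge[OF t])
      fix u :: "real \<Rightarrow> 'u" assume u: "u \<in> controls"
      obtain v where v: "v \<in> controls"
        and tr: "\<And>s. s \<in> {0..t} \<Longrightarrow>
          (norm (trajectory g s u y\<^sub>1 - trajectory g s v y\<^sub>2))\<^sup>2 \<le> (norm (y\<^sub>1 - y\<^sub>2))\<^sup>2 + \<epsilon>"
        using tracking_control[OF y u \<epsilon>(1), of t] t by auto
      have "cost t v y\<^sub>2 \<le> integral {0..t} (\<lambda>s. h (trajectory g s u y\<^sub>1) + e)"
        unfolding cost_def
      proof (rule integral_le)
        fix s assume s: "s \<in> {0..t}"
        have "(norm (trajectory g s u y\<^sub>1 - trajectory g s v y\<^sub>2))\<^sup>2 < d\<^sup>2"
          using tr[OF s] \<epsilon>(2) by linarith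
        then have "norm (trajectory g s u y\<^sub>1 - trajectory g s v y\<^sub>2) < d"
          using d by (simp add: power_less_imp_less_base)
        then show "h (trajectory g s v y\<^sub>2) \<le> h (trajectory g s u y\<^sub>1) + e"
          using h[of "trajectory g s v y\<^sub>2" "trajectory g s u y\<^sub>1"] s y u v
          by (auto simp: trajectory_in_N abs_less_iff)
      qed (auto intro!: integrable_add running_cost_integrable u v)
      also have "\<dots> = cost t u y\<^sub>1 + t * e"
        using t unfolding cost_def
        by (subst Henstock_Kurzweil_Integration.integral_add) (auto intro!: running_cost_integrable u)
      finally show "t * (V t y\<^sub>2 - e) \<le> cost t u y\<^sub>1"
        using value_function_le[OF y(2) v t] by (simp add: algebra_simps)
    qed
    then show ?thesis by simp
  qed
  have "\<bar>V t y\<^sub>1 - V t y\<^sub>2\<bar> \<le> e"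
    if "t > 0" "y\<^sub>1 \<in> N" "y\<^sub>2 \<in> N" "norm (y\<^sub>1 - y\<^sub>2) < d" for t y\<^sub>1 y\<^sub>2
    using le[OF that] le[OF that(1,3,2)] that(4) by (simp add: abs_le_iff norm_minus_commute)
  then show thesis using d that by blast
qed

text \<open>From \<open>y\<close> one may first go to the point \<open>z\<close> reached at time \<open>\<tau>\<close> and continue as from \<open>z\<close>.
Compared with a start at \<open>z\<close>, the total cost changes by the cost of the first \<open>\<tau>\<close> time units and by that of the last \<open>\<tau>\<close>
time units, which are cut off.\<close>

lemma value_function_along_trajectory:
  assumes y: "y \<in> N" and u: "u \<in> controls" and \<tau>: "0 \<le> \<tau>" and t: "\<tau> < t"
  shows "V t y \<le> V t (trajectory g \<tau> u y) + 2 * M * \<tau> / t"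
proof -
  let ?z = "trajectory g \<tau> u y"
  have z: "?z \<in> N" using y u \<tau> by (rule trajectory_in_N)
  have t0: "t > 0" using \<tau> t by simp
  have "V t y - 2 * M * \<tau> / t \<le> V t ?z"
  proof (rule value_function_ge[OF t0])
    fix v :: "real \<Rightarrow> 'u" assume v: "v \<in> controls"
    define w where "w = switch_control \<tau> u v"
    have w: "w \<in> controls" unfolding w_def using u v \<tau> by (rule switch_in_controls)
    define r where "r = t - \<tau>"
    have r: "r \<ge> 0" using t by (simp add: r_def)
    have wz: "trajectory g \<tau> w y = ?z" unfolding w_def using u v \<tau> by (simp add: trajectory_switch)
    have shift_w: "(\<lambda>s. w (s + \<tau>)) \<in> controls" using w \<tau> by (rule shift_in_controls)
    have "trajectory g s (\<lambda>s. w (s + \<tau>)) ?z = trajectory g s v ?z" if "s \<ge> 0" for s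
    proof -
      have "trajectory g s (\<lambda>s. w (s + \<tau>)) ?z = trajectory g (s + \<tau>) w y"
        using trajectory_shift[OF w \<tau> that, of y] wz by simp
      also have "\<dots> = trajectory g s v ?z"
        unfolding w_def using trajectory_switch[OF u v \<tau>, of "s + \<tau>" y] that \<tau> v
        by (cases "s = 0") (auto simp: trajectory_0)
      finally show ?thesis .
    qed
    then have eq: "cost r (\<lambda>s. w (s + \<tau>)) ?z = cost r v ?z"
      unfolding cost_def by (intro integral_cong) simp
    have "t * V t y \<le> cost (r + \<tau>) w y" using value_function_le[OF y w t0] by (simp add: r_def)
    also have "\<dots> = cost \<tau> w y + cost r v ?z" using cost_split[OF w \<tau> r, of y] wz eq by simp
    also have "\<dots> \<le> M * \<tau> + cost r v ?z" using cost_bound[OF y w \<tau>] by simp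
    also have "cost t v ?z = cost r v ?z + cost \<tau> (\<lambda>s. v (s + r)) (trajectory g r v ?z)"
      using cost_split[OF v r \<tau>, of ?z] by (simp add: r_def)
    then have "cost r v ?z \<le> cost t v ?z + M * \<tau>"
      using cost_bound[OF trajectory_in_N[OF z v r] shift_in_controls[OF v r] \<tau>] by (simp add: abs_le_iff)
    finally have "t * V t y \<le> cost t v ?z + 2 * M * \<tau>" by (simp add: mult_ac)
    then show "t * (V t y - 2 * M * \<tau> / t) \<le> cost t v ?z"
      using t0 by (simp add: algebra_simps)
  qed
  then show ?thesis by simp
qed

text \<open>The cost on each block of length \<open>T\<close> is at least \<open>T\<close> times the value at the state where the block
starts. The term \<open>2 * M * T\<close> accounts for the incomplete last block.\<close>

lemma cost_ge_of_blocks: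
  assumes y: "y \<in> N" and u: "u \<in> controls" and T: "T > 0" and t: "t \<ge> 0"
    and c: "\<And>\<tau>. \<tau> \<ge> 0 \<Longrightarrow> c \<le> V T (trajectory g \<tau> u y)"
  shows "t * c - 2 * M * T \<le> cost t u y"
proof -
  have blocks: "real n * T * c \<le> cost (real n * T) u y" for n
  proof (induction n)
    case 0 then show ?case by (simp add: cost_def)
  next
    case (Suc n)
    define \<tau> where "\<tau> = real n * T"
    have \<tau>: "\<tau> \<ge> 0" using T by (simp add: \<tau>_def)
    have "T * c \<le> T * V T (trajectory g \<tau> u y)" using c[OF \<tau>] T by simp
    also have "\<dots> \<le> cost T (\<lambda>s. u (s + \<tau>)) (trajectory g \<tau> u y)"
      using y u \<tau> T by (intro value_function_le trajectory_in_N shift_in_controls) auto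
    finally have "cost (T + \<tau>) u y \<ge> cost \<tau> u y + T * c"
      using cost_split[OF u \<tau>, of T y] T by simp
    then show ?case using Suc.IH by (simp add: \<tau>_def algebra_simps)
  qed
  have cM: "c \<le> M" 
    using c[of 0] value_function_bound[OF y T] u by (simp add: trajectory_0)
  have M0: "M \<ge> 0" using h_bound[OF y] by linarith
  define n where "n = nat \<lfloor>t / T\<rfloor>"
  have "real n = of_int \<lfloor>t / T\<rfloor>" using t T by (simp add: n_def)
  then have n1: "real n \<le> t / T" "t / T < real n + 1" by linarith+
  define \<tau> where "\<tau> = real n * T"
  have \<tau>: "0 \<le> \<tau>" "\<tau> \<le> t" "t - \<tau> \<le> T" using n1 T by (auto simp: \<tau>_def field_simps)
  have "cost t u y = cost \<tau> u y + cost (t - \<tau>) (\<lambda>s. u (s + \<tau>)) (trajectory g \<tau> u y)"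
    using cost_split[OF u \<tau>(1), of "t - \<tau>" y] \<tau> by simp
  moreover have "\<bar>cost (t - \<tau>) (\<lambda>s. u (s + \<tau>)) (trajectory g \<tau> u y)\<bar> \<le> M * (t - \<tau>)"
    using y u \<tau> by (intro cost_bound trajectory_in_N shift_in_controls) auto
  moreover have "M * (t - \<tau>) \<le> M * T" using M0 \<tau> by (intro mult_left_mono)
  moreover have "\<tau> * c \<le> cost \<tau> u y" using blocks[of n] by (simp add: \<tau>_def)
  moreover have "(t - \<tau>) * c \<le> (t - \<tau>) * M" using cM \<tau> by (intro mult_left_mono) auto
  ultimately show ?thesis by (simp add: algebra_simps)
qed

section \<open>Convergence\<close>

text \<open>The time needed to reach the later state is negligible in an average over a horizon that tends to
infinity.\<close>

lemma limit_value_nondecreasing_along_trajectories: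
  assumes s: "filterlim s at_top sequentially"
    and W: "\<And>z. z \<in> N \<Longrightarrow> (\<lambda>n. V (s n) z) \<longlonglongrightarrow> W z"
    and y: "y \<in> N" and u: "u \<in> controls" and \<tau>: "\<tau> \<ge> 0"
  shows "W y \<le> W (trajectory g \<tau> u y)"
proof (rule tendsto_le[OF sequentially_bot _ W[OF y]])
  let ?z = "trajectory g \<tau> u y"
  have z: "?z \<in> N" using y u \<tau> by (rule trajectory_in_N)
  have "(\<lambda>n. 2 * M * \<tau> / s n) \<longlonglongrightarrow> 0"
    by (rule tendsto_divide_0[OF tendsto_const]) (rule filterlim_mono[OF s at_top_le_at_infinity order_refl])
  with W[OF z] show "(\<lambda>n. V (s n) ?z + 2 * M * \<tau> / s n) \<longlonglongrightarrow> W ?z"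
    using tendsto_add[of "\<lambda>n. V (s n) ?z" "W ?z" sequentially "\<lambda>n. 2 * M * \<tau> / s n" 0] by simp
  have "eventually (\<lambda>n. \<tau> < s n) sequentially"
    using s by (simp add: filterlim_at_top_dense)
  then show "eventually (\<lambda>n. V (s n) y \<le> V (s n) ?z + 2 * M * \<tau> / s n) sequentially"
    by (rule eventually_mono) (rule value_function_along_trajectory[OF y u \<tau>])
qed

text \<open>Uniform convergence provides one horizon \<open>T\<close> at which \<open>V\<close> is close to \<open>W\<close> at all states
visited, hence at least \<open>W y\<close> up to a small error by monotonicity along the trajectory; this bound is
used on every block of length \<open>T\<close>.\<close>

lemma uniform_limit_le_eventually:
  assumes s: "filterlim s at_top sequentially"
    and W: "uniform_limit N (\<lambda>n. V (s n)) W sequentially"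
    and y: "y \<in> N" and "e > 0"
  shows "eventually (\<lambda>t. W y - e \<le> V t y) at_top"
proof -
  have "eventually (\<lambda>n. s n > 0 \<and> (\<forall>z\<in>N. dist (V (s n) z) (W z) < e / 2)) sequentially"
    using s W \<open>e > 0\<close> by (intro eventually_conj uniform_limitD) (simp_all add: filterlim_at_top_dense)
  then obtain T where T: "T > 0" and close: "\<And>z. z \<in> N \<Longrightarrow> \<bar>V T z - W z\<bar> < e / 2"
    by (auto simp: eventually_sequentially dist_real_def)
  have c: "W y - e / 2 \<le> V T (trajectory g \<tau> u y)" if "u \<in> controls" "\<tau> \<ge> 0" for u \<tau>
  proof -
    have "W y \<le> W (trajectory g \<tau> u y)"
      using s tendsto_uniform_limitI[OF W] y that
      by (rule limit_value_nondecreasing_along_trajectories)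
    then show ?thesis using close[OF trajectory_in_N[OF y that]] by linarith
  qed
  have "W y - e \<le> V t y" if t: "t \<ge> max 1 (4 * M * T / e)" for t
  proof (rule value_function_ge)
    show "t > 0" using t by simp
    fix u :: "real \<Rightarrow> 'u" assume u: "u \<in> controls"
    have "t * (W y - e / 2) - 2 * M * T \<le> cost t u y"
      using y u T _ c[OF u] by (rule cost_ge_of_blocks) (use t in auto)
    moreover have "2 * M * T \<le> t * (e / 2)" using t \<open>e > 0\<close> by (simp add: field_simps)
    ultimately show "t * (W y - e) \<le> cost t u y" by (simp add: algebra_simps)
  qed
  then show ?thesis unfolding eventually_at_top_linorder by blast
qed

lemma value_functions_subsequence:
  assumes s: "filterlim s at_top sequentially" "\<And>n. s n > 0"
  obtains r W where "strict_mono (r :: nat \<Rightarrow> nat)"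
    "uniform_limit N (\<lambda>n. V (s (r n))) W sequentially"
proof -
  obtain W r where r: "strict_mono (r :: nat \<Rightarrow> nat)"
    and W: "\<And>e. 0 < e \<Longrightarrow> \<exists>n\<^sub>0. \<forall>n x. n \<ge> n\<^sub>0 \<and> x \<in> N \<longrightarrow> norm (V (s (r n)) x - W x) < e"
  proof (rule Arzela_Ascoli[of N "\<lambda>n. V (s n)" M])
    show "norm (V (s n) x) \<le> M" if "x \<in> N" for n x
      using value_function_bound[OF that s(2)] by simp
    show "\<exists>d>0. \<forall>n y. y \<in> N \<and> norm (x - y) < d \<longrightarrow> norm (V (s n) x - V (s n) y) < e"
      if x: "x \<in> N" and e: "0 < e" for x e
    proof -
      obtain d where "d > 0" and d: "\<And>t y\<^sub>1 y\<^sub>2. \<lbrakk>t > 0; y\<^sub>1 \<in> N; y\<^sub>2 \<in> N; norm (y\<^sub>1 - y\<^sub>2) < d\<rbrakk>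
          \<Longrightarrow> \<bar>V t y\<^sub>1 - V t y\<^sub>2\<bar> \<le> e / 2"
        using value_functions_equicontinuous[of "e / 2"] e by auto
      have "norm (V (s n) x - V (s n) z) < e" if "z \<in> N" "norm (x - z) < d" for n z
        using d[OF s(2) x that, of n] e by simp
      then show ?thesis using \<open>d > 0\<close> by blast
    qed
  qed (use compact_N in blast)+
  have "uniform_limit N (\<lambda>n. V (s (r n))) W sequentially"
  proof (rule uniform_limitI)
    fix e :: real assume "e > 0"
    from W[OF this] show "eventually (\<lambda>n. \<forall>x\<in>N. dist (V (s (r n)) x) (W x) < e) sequentially"
      by (auto simp: eventually_sequentially dist_norm)
  qed
  with r show thesis by (rule that)
qed

text \<open>By compactness every sequence of times tending to infinity has a limit of values along a
subsequence, and each such limit bounds the values from below in the long run. So no two of these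
limits can differ.\<close>

lemma value_function_convergent:
  assumes y: "y \<in> N"
  shows "\<exists>l. ((\<lambda>t. V t y) \<longlongrightarrow> l) at_top"
proof -
  have accumulation: "\<exists>l. (\<forall>e>0. eventually (\<lambda>t. l - e \<le> V t y) at_top) \<and>
      (\<exists>r. strict_mono r \<and> (\<lambda>n. V (s (r n)) y) \<longlonglongrightarrow> l)"
    if s: "filterlim s at_top sequentially" "\<And>n. s n > 0" for s :: "nat \<Rightarrow> real"
  proof -
    obtain r W where r: "strict_mono (r :: nat \<Rightarrow> nat)"
      and W: "uniform_limit N (\<lambda>n. V (s (r n))) W sequentially"
      using value_functions_subsequence[OF s] by blast
    have "filterlim (\<lambda>n. s (r n)) at_top sequentially"
      using filterlim_compose[OF s(1) filterlim_subseq[OF r]] .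
    then have "\<forall>e>0. eventually (\<lambda>t. W y - e \<le> V t y) at_top"
      using uniform_limit_le_eventually[OF _ W y] by blast
    moreover have "(\<lambda>n. V (s (r n)) y) \<longlonglongrightarrow> W y" using tendsto_uniform_limitI[OF W y] .
    ultimately show ?thesis using r by blast
  qed
  have "filterlim (\<lambda>n. real (Suc n)) at_top sequentially"
    by (rule filterlim_compose[OF filterlim_real_sequentially filterlim_Suc])
  then obtain l r\<^sub>0 where
    l: "\<And>e. e > 0 \<Longrightarrow> eventually (\<lambda>t. l - e \<le> V t y) at_top"
    and r\<^sub>0: "strict_mono r\<^sub>0" "(\<lambda>n. V (real (Suc (r\<^sub>0 n))) y) \<longlonglongrightarrow> l"
    using accumulation[of "\<lambda>n. real (Suc n)"] by auto
  have upper: "eventually (\<lambda>t. V t y < l + e) at_top" if "e > 0" for e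
  proof (rule ccontr)
    \<comment> \<open>Otherwise an accumulation value \<open>l' \<ge> l + e\<close> bounds the values from below in the long run, although they return to \<open>l\<close>.\<close>
    assume "\<not> eventually (\<lambda>t. V t y < l + e) at_top"
    then have "\<forall>n::nat. \<exists>t \<ge> real (Suc n). l + e \<le> V t y"
      unfolding eventually_at_top_linorder by (meson not_less)
    then obtain s where s: "\<And>n. s n \<ge> real (Suc n)" "\<And>n. l + e \<le> V (s n) y" by metis
    have "filterlim s at_top sequentially"
      by (rule filterlim_at_top_mono[OF \<open>filterlim (\<lambda>n. real (Suc n)) at_top sequentially\<close>])
         (use s(1) in \<open>auto intro!: always_eventually\<close>)
    moreover have "s n > 0" for n using s(1)[of n] by simp
    ultimately obtain l' r where l': "\<And>e. e > 0 \<Longrightarrow> eventually (\<lambda>t. l' - e \<le> V t y) at_top"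
      and r: "(\<lambda>n. V (s (r n)) y) \<longlonglongrightarrow> l'" using accumulation[of s] by blast
    have "l + e \<le> l'" using r s(2) by (intro LIMSEQ_le_const[OF r]) auto
    have "filterlim (\<lambda>n. real (Suc (r\<^sub>0 n))) at_top sequentially"
      using filterlim_compose[OF \<open>filterlim (\<lambda>n. real (Suc n)) at_top sequentially\<close>
          filterlim_subseq[OF r\<^sub>0(1)]] .
    then have "eventually (\<lambda>n. l' - e / 2 \<le> V (real (Suc (r\<^sub>0 n))) y) sequentially"
      using l'[of "e / 2"] \<open>e > 0\<close> by (auto simp: filterlim_iff)
    then have "l' - e / 2 \<le> l"
      by (intro tendsto_lowerbound[OF r\<^sub>0(2)]) auto
    then show False using \<open>l + e \<le> l'\<close> \<open>e > 0\<close> by simp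
  qed
  have "((\<lambda>t. V t y) \<longlongrightarrow> l) at_top"
  proof (rule order_tendstoI)
    fix b assume "b < l"
    with l[of "(l - b) / 2"] have "eventually (\<lambda>t. l - (l - b) / 2 \<le> V t y) at_top" by simp
    then show "eventually (\<lambda>t. b < V t y) at_top"
      by (rule eventually_mono) (use \<open>b < l\<close> in \<open>simp add: field_simps\<close>)
  next
    fix b assume "l < b"
    with upper[of "b - l"] show "eventually (\<lambda>t. V t y < b) at_top" by simp
  qed
  then show ?thesis by blast
qed

end

section \<open>Existence of the limit value\<close>

theorem proposition1p1:
  fixes g :: "(real^'d) \<times> 'u::metric_space \<Rightarrow> real^'d"
    and h :: "real^'d \<Rightarrow> real"
    and N :: "(real^'d) set"
  assumes measurable: "g \<in> borel_measurable (borel \<Otimes>\<^sub>M borel)"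
    and Lipschitz: "\<exists>L\<ge>0. \<forall>y y' u. norm (g (y, u) - g (y', u)) \<le> L * norm (y - y')"
    and linear_growth: "\<exists>a>0. \<forall>y u. norm (g (y, u)) \<le> a * (1 + norm y)"
    and continuous: "continuous_on UNIV h"
    and compact: "compact N"
    and invariant: "forward_invariant g N"
    and nonexpansive:
      "\<forall>y\<^sub>1\<in>N. \<forall>y\<^sub>2\<in>N. (SUP u. INF v. (y\<^sub>1 - y\<^sub>2) \<bullet> (g (y\<^sub>1, u) - g (y\<^sub>2, v))) \<le> 0"
  shows "\<forall>y\<^sub>0\<in>N. \<exists>V. ((\<lambda>t. value_function g h t y\<^sub>0) \<longlongrightarrow> V) at_top"
proof -
  obtain L where L: "L \<ge> 0" "\<forall>y y' u. norm (g (y, u) - g (y', u)) \<le> L * norm (y - y')"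
    using Lipschitz by blast
  obtain a where a: "a > 0" "\<forall>y u. norm (g (y, u)) \<le> a * (1 + norm y)"
    using linear_growth by blast
  interpret nonexpansive_control_system g L a N h
    using measurable L a compact invariant continuous nonexpansive by unfold_locales blast+
  show ?thesis using value_function_convergent by blast
qed

end
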